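(* For every $t>0$ and $r\geqslant0$, one has $$G_1^{(1)}(t,r)=2\pi\int_r^\infty G_1^{(3)}(t,\ell)\,\ell\,\mathrm d\ell.$$ Consequently, for every fixed $t>0$, the function $r\mapsto G_1^{(1)}(t,r)$ is nonnegative and nonincreasing on $[0,\infty)$.
   Context: For $\rho\geqslant0$ let $\widehat S_1(t,\rho)$ be the solution of the ODE in $t$, $y''+\rho^2y'+\rho^2y=0$, $y(0)=0$, $y'(0)=1$. For $n\in\{1,3\}$, $G_1^{(n)}(t,x)$, $x\in\mathbb R^n$, is the $n$-dimensional velocity fundamental solution of $v_{tt}-\Delta v-\Delta v_t=0$, i.e. the tempered distribution whose spatial Fourier transform (convention $\widehat f(\zeta)=\int_{\mathbb R^n}\mathrm e^{-ix\cdot\zeta}f(x)\,\mathrm dx$) is $\widehat S_1(t,|\zeta|)$. $G_1^{(1)}(t,\cdot)$ is an even continuous function on $\mathbb R$. $G_1^{(3)}(t,\cdot)$ is radial, and for $r=|x|>0$ one writes $G_1^{(3)}(t,r)=G_1^{(3)}(t,x)$, given pointwise by $G_1^{(3)}(t,r)=\frac{1}{2\pi^2r}\lim_{R\to\infty}\int_0^R\widehat S_1(t,\rho)\,\rho\sin(r\rho)\,\mathrm d\rho$. *)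

theory Defs
  imports "HOL-Analysis.Analysis"
begin

definition S1_solution :: "real \<Rightarrow> (real \<Rightarrow> real) \<Rightarrow> bool" where
  "S1_solution \<rho> y \<longleftrightarrow>
     y 0 = 0 \<and>
     (\<exists>y'. y' 0 = 1 \<and>
        (\<forall>t. (y has_real_derivative y' t) (at t)) \<and>
        (\<forall>t. \<exists>y2. (y' has_real_derivative y2) (at t) \<and> y2 + \<rho>\<^sup>2 * y' t + \<rho>\<^sup>2 * y t = 0))"

text \<open>The equation is imposed on the whole real line, so that the solution is unique as a total
  function; for nonnegative times it is the solution of the forward problem.\<close>

definition S1_hat :: "real \<Rightarrow> real \<Rightarrow> real" where
  "S1_hat t \<rho> = (THE y. S1_solution \<rho> y) t"

fun iterated_partial :: "'a::euclidean_space list \<Rightarrow> ('a \<Rightarrow> complex) \<Rightarrow> 'a \<Rightarrow> complex" where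
  "iterated_partial [] f = f"
| "iterated_partial (b # bs) f = (\<lambda>x. frechet_derivative (iterated_partial bs f) (at x) b)"

text \<open>A function is smooth iff all its iterated partial derivatives exist and are differentiable.\<close>

definition schwartz :: "('a::euclidean_space \<Rightarrow> complex) \<Rightarrow> bool" where
  "schwartz \<phi> \<longleftrightarrow>
     (\<forall>bs \<in> lists Basis.
        (\<forall>x. iterated_partial bs \<phi> differentiable (at x)) \<and>
        (\<forall>k. bounded (range (\<lambda>x. norm x ^ k *\<^sub>R iterated_partial bs \<phi> x))))"

definition schwartz_seminorm :: "nat \<Rightarrow> ('a::euclidean_space \<Rightarrow> complex) \<Rightarrow> real" where
  "schwartz_seminorm N \<phi> =
     (SUP (k, bs, x) \<in> {..N} \<times> {bs \<in> lists Basis. length bs \<le> N} \<times> UNIV.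
        norm x ^ k * norm (iterated_partial bs \<phi> x))"

text \<open>Distributions are total functionals on functions; only their values at Schwartz functions
  are meaningful.\<close>

definition tempered_distribution :: "(('a::euclidean_space \<Rightarrow> complex) \<Rightarrow> complex) \<Rightarrow> bool" where
  "tempered_distribution T \<longleftrightarrow>
     (\<forall>\<phi> \<psi>. schwartz \<phi> \<longrightarrow> schwartz \<psi> \<longrightarrow> T (\<lambda>x. \<phi> x + \<psi> x) = T \<phi> + T \<psi>) \<and>
     (\<forall>c \<phi>. schwartz \<phi> \<longrightarrow> T (\<lambda>x. c * \<phi> x) = c * T \<phi>) \<and>
     (\<exists>C N. \<forall>\<phi>. schwartz \<phi> \<longrightarrow> norm (T \<phi>) \<le> C * schwartz_seminorm N \<phi>)"

definition fourier :: "('a::euclidean_space \<Rightarrow> complex) \<Rightarrow> 'a \<Rightarrow> complex" where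
  "fourier f \<zeta> = (LINT x|lborel. exp (- (\<i> * of_real (x \<bullet> \<zeta>))) * f x)"

definition fourier_distribution ::
    "(('a::euclidean_space \<Rightarrow> complex) \<Rightarrow> complex) \<Rightarrow> ('a \<Rightarrow> complex) \<Rightarrow> complex" where
  "fourier_distribution T \<phi> = T (fourier \<phi>)"

definition regular_distribution ::
    "('a::euclidean_space \<Rightarrow> real) \<Rightarrow> ('a \<Rightarrow> complex) \<Rightarrow> complex" where
  "regular_distribution f \<phi> = (LINT x|lborel. of_real (f x) * \<phi> x)"

definition velocity_fundamental_solution ::
    "real \<Rightarrow> (('a::euclidean_space \<Rightarrow> complex) \<Rightarrow> complex) \<Rightarrow> bool" where
  "velocity_fundamental_solution t T \<longleftrightarrow>
     tempered_distribution T \<and>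
     (\<forall>\<phi>. schwartz \<phi> \<longrightarrow>
        fourier_distribution T \<phi> = regular_distribution (\<lambda>\<zeta>. S1_hat t (norm \<zeta>)) \<phi>)"

text \<open>Integrability is required explicitly because the Bochner integral of a non-integrable
  function is 0.\<close>

definition velocity_fundamental_function ::
    "real \<Rightarrow> ('a::euclidean_space \<Rightarrow> real) \<Rightarrow> bool" where
  "velocity_fundamental_function t f \<longleftrightarrow>
     (\<forall>\<phi>. schwartz \<phi> \<longrightarrow> integrable lborel (\<lambda>x. of_real (f x) * \<phi> x)) \<and>
     velocity_fundamental_solution t (regular_distribution f)"

end

theory Submission
  imports Defs "HOL-Probability.Probability" "HOL-Real_Asymp.Real_Asymp"
    "HOL-Computational_Algebra.Polynomial"
begin

text \<open>
  Write the solution of the frequency equation as \<open>exp (- t) * z\<close>.  Then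
  \<open>z'' + (\<rho>\<^sup>2 - 2) z' + z = 0\<close>, and the Laplace transform of \<open>z\<close> in time is
  \<open>1 / (p (\<rho>\<^sup>2 + a\<^sup>2))\<close> with \<open>a = sqrt p - 1 / sqrt p\<close>.  Since \<open>\<rho> / (\<rho>\<^sup>2 + a\<^sup>2)\<close> is the sine
  transform of \<open>r \<mapsto> exp (- a r)\<close>, the function \<open>\<rho> z\<close> is the sine transform of a profile \<open>\<Phi>\<close> whose
  Laplace transform in time is
  \<open>(1 / p) exp (- r sqrt p) exp (r / sqrt p)\<close>.
  All three factors are completely monotone in \<open>p\<close>, so \<open>\<Phi> \<ge> 0\<close>; this is the whole reason for the
  positivity.  Inverting the transform gives the explicit profile
  \<open>\<Phi> t r = (\<integral>u\<ge>0. I\<^sub>0 (2 sqrt (r u)) exp (- (r + u)\<^sup>2 / (4 t)) / sqrt (\<pi> t))\<close>.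

  The proof takes this integral as the definition of \<open>\<Phi>\<close> and needs no Laplace transform:
  expanding sine and Bessel function, every term of the sine transform of \<open>\<Phi>\<close> is a Gaussian
  moment, and the resulting power series in \<open>t\<close> has exactly the Taylor coefficients of \<open>\<rho> z\<close>
  (\<open>freq_series_eq_sine_transform\<close>).

  Two consequences give the relation between the dimensions.  In three dimensions, \<open>\<Phi>\<close> is the tail
  integral of an integrable function, and so the sine transform can be inverted pointwise
  (\<open>sine_inversion\<close>), which shows that \<open>4 \<pi> l G3 t l = exp (- t) \<Phi> t l\<close>.  In one dimension,
  \<open>x \<mapsto> (exp (- t) / 2) (\<integral>v\<ge>\<bar>x\<bar>. \<Phi> t v)\<close> is continuous, integrable and has the prescribed Fourier
  transform, so it is \<open>G1 t\<close>, because testing against ever narrower Gaussians recovers the value of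
  a continuous function at a point (\<open>velocity_fundamental_function_unique\<close>).  The tail integral of a
  nonnegative function is nonnegative and nonincreasing.
\<close>

section \<open>The frequency side as a power series in time\<close>

text \<open>After the substitution \<open>y = exp (- t) * z\<close> the equation for \<open>y\<close> reads
  \<open>z'' + (\<rho>\<^sup>2 - 2) z' + z = 0\<close>; these are the derivatives of \<open>z\<close> at \<open>0\<close>.\<close>
fun freq_coeff :: "real \<Rightarrow> nat \<Rightarrow> real" where
  "freq_coeff \<rho> 0 = 0"
| "freq_coeff \<rho> (Suc 0) = 1"
| "freq_coeff \<rho> (Suc (Suc n)) = (2 - \<rho>\<^sup>2) * freq_coeff \<rho> (Suc n) - freq_coeff \<rho> n"

text \<open>The \<open>k\<close>-th derivative of \<open>z\<close>: differentiating an exponential generating function shifts its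
  coefficients.\<close>
definition freq_series :: "real \<Rightarrow> nat \<Rightarrow> real \<Rightarrow> real" where
  "freq_series \<rho> k t = (\<Sum>n. freq_coeff \<rho> (n + k) / fact n * t ^ n)"

lemma freq_coeff_bound: "\<bar>freq_coeff \<rho> n\<bar> \<le> (3 + \<rho>\<^sup>2) ^ n"
proof (induction n rule: induct_nat_012)
  case (ge2 n)
  let ?M = "3 + \<rho>\<^sup>2"
  have "\<bar>freq_coeff \<rho> (Suc (Suc n))\<bar> \<le> \<bar>2 - \<rho>\<^sup>2\<bar> * \<bar>freq_coeff \<rho> (Suc n)\<bar> + \<bar>freq_coeff \<rho> n\<bar>"
    by (simp add: abs_mult[symmetric])
  also have "\<dots> \<le> (2 + \<rho>\<^sup>2) * ?M ^ Suc n + ?M ^ n"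
    using ge2 by (intro add_mono mult_mono) (auto simp: abs_le_iff)
  also have "?M ^ n \<le> ?M ^ Suc n"
    by (intro power_increasing) auto
  also have "(2 + \<rho>\<^sup>2) * ?M ^ Suc n + ?M ^ Suc n = ?M ^ Suc (Suc n)"
    by (simp add: algebra_simps)
  finally show ?case by simp
qed auto

lemma summable_freq_series: "summable (\<lambda>n. freq_coeff \<rho> (n + k) / fact n * t ^ n)"
proof (rule summable_comparison_test')
  let ?M = "3 + \<rho>\<^sup>2"
  show "summable (\<lambda>n. ?M ^ k * (inverse (fact n) * (?M * \<bar>t\<bar>) ^ n))"
    by (intro summable_mult summable_exp)
  fix n
  have "\<bar>freq_coeff \<rho> (n + k)\<bar> * (\<bar>t\<bar> ^ n / fact n) \<le> ?M ^ (n + k) * (\<bar>t\<bar> ^ n / fact n)"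
    by (intro mult_right_mono freq_coeff_bound) auto
  then show "norm (freq_coeff \<rho> (n + k) / fact n * t ^ n) \<le> ?M ^ k * (inverse (fact n) * (?M * \<bar>t\<bar>) ^ n)"
    unfolding power_mult_distrib
    by (simp only: power_add real_norm_def abs_mult abs_divide abs_inverse abs_of_nonneg[OF fact_ge_zero] power_abs divide_inverse mult_ac)
qed

lemma DERIV_freq_series:
  "(freq_series \<rho> k has_real_derivative freq_series \<rho> (Suc k) t) (at t)"
proof -
  have "diffs (\<lambda>n. freq_coeff \<rho> (n + k) / fact n) = (\<lambda>n. freq_coeff \<rho> (n + Suc k) / fact n)"
    by (auto simp: diffs_def fun_eq_iff simp del: freq_coeff.simps of_nat_Suc)
  then show ?thesis
    using termdiffs_strong_converges_everywhere[of "\<lambda>n. freq_coeff \<rho> (n + k) / fact n" t]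
      summable_freq_series
    by (simp add: freq_series_def[abs_def])
qed

lemma freq_series_recurrence:
  "freq_series \<rho> 2 t + (\<rho>\<^sup>2 - 2) * freq_series \<rho> 1 t + freq_series \<rho> 0 t = 0"
proof -
  note s = summable_freq_series[of \<rho> _ t, THEN summable_sums]
  have "(\<lambda>n. freq_coeff \<rho> (n + 2) / fact n * t ^ n
         + (\<rho>\<^sup>2 - 2) * (freq_coeff \<rho> (n + 1) / fact n * t ^ n)
         + freq_coeff \<rho> (n + 0) / fact n * t ^ n) sums
       (freq_series \<rho> 2 t + (\<rho>\<^sup>2 - 2) * freq_series \<rho> 1 t + freq_series \<rho> 0 t)"
    unfolding freq_series_def by (intro sums_add sums_mult s)
  moreover have "freq_coeff \<rho> (n + 2) / fact n * t ^ n
         + (\<rho>\<^sup>2 - 2) * (freq_coeff \<rho> (n + 1) / fact n * t ^ n)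
         + freq_coeff \<rho> (n + 0) / fact n * t ^ n = 0" for n
    by (simp add: numeral_2_eq_2 field_simps)
  ultimately show ?thesis
    by (metis (no_types, lifting) sums_0 sums_unique2 sums_cong)
qed

text \<open>The energy \<open>E = d\<^sup>2 + d'\<^sup>2\<close> satisfies \<open>\<bar>E'\<bar> \<le> C E\<close>.  Hence \<open>E exp (- C t)\<close> decreases and
  \<open>E exp (C t)\<close> increases, so that an energy vanishing at time \<open>0\<close> vanishes in the future and in the past.\<close>
lemma linear_ode_zero:
  fixes d d' :: "real \<Rightarrow> real"
  assumes d: "\<And>t. (d has_real_derivative d' t) (at t)"
    and d': "\<And>t. (d' has_real_derivative - (\<rho>\<^sup>2 * d' t) - \<rho>\<^sup>2 * d t) (at t)"
    and init: "d 0 = 0" "d' 0 = 0"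
  shows "d t = 0"
proof -
  define C where "C = 1 + 3 * \<rho>\<^sup>2"
  define E where "E t = (d t)\<^sup>2 + (d' t)\<^sup>2" for t
  define E' where "E' t = 2 * d t * d' t + 2 * d' t * (- (\<rho>\<^sup>2 * d' t) - \<rho>\<^sup>2 * d t)" for t
  have E: "(E has_real_derivative E' t) (at t)" for t
    unfolding E_def[abs_def] E'_def
    by (rule derivative_eq_intros d d' refl | simp)+
  have E'_bound: "\<bar>E' t\<bar> \<le> C * E t" for t
  proof -
    have sq: "0 \<le> (\<bar>d t\<bar> - \<bar>d' t\<bar>)\<^sup>2" by simp
    have "E' t = 2 * (1 - \<rho>\<^sup>2) * (d t * d' t) - 2 * \<rho>\<^sup>2 * (d' t)\<^sup>2"
      by (simp add: E'_def algebra_simps power2_eq_square)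
    then have "\<bar>E' t\<bar> \<le> \<bar>2 * (1 - \<rho>\<^sup>2) * (d t * d' t)\<bar> + \<bar>2 * \<rho>\<^sup>2 * (d' t)\<^sup>2\<bar>"
      by linarith
    also have "\<dots> = \<bar>1 - \<rho>\<^sup>2\<bar> * (2 * (\<bar>d t\<bar> * \<bar>d' t\<bar>)) + 2 * \<rho>\<^sup>2 * (d' t)\<^sup>2"
      by (simp only: abs_mult abs_numeral abs_power2 mult_ac)
    also have "\<dots> \<le> (1 + \<rho>\<^sup>2) * E t + 2 * \<rho>\<^sup>2 * E t"
      using sq by (intro add_mono mult_mono) (auto simp: E_def power2_diff abs_if)
    finally show ?thesis by (simp add: C_def algebra_simps)
  qed
  have E0: "E 0 = 0" by (simp add: E_def init)
  have "E t \<le> 0"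
  proof (cases "t \<ge> 0")
    case True
    have "E t * exp (- C * t) \<le> E 0 * exp (- C * 0)"
    proof (rule DERIV_nonpos_imp_nonincreasing[OF True])
      fix x
      have "((\<lambda>t. E t * exp (- C * t)) has_real_derivative (E' x - C * E x) * exp (- C * x)) (at x)"
        by (rule derivative_eq_intros E refl | simp add: algebra_simps)+
      moreover have "(E' x - C * E x) * exp (- C * x) \<le> 0"
        using E'_bound[of x] by (intro mult_nonpos_nonneg) auto
      ultimately show "\<exists>y. ((\<lambda>t. E t * exp (- C * t)) has_real_derivative y) (at x) \<and> y \<le> 0"
        by blast
    qed
    then show ?thesis by (simp add: E0 mult_le_0_iff)
  next
    case False
    have "E t * exp (C * t) \<le> E 0 * exp (C * 0)"
    proof (rule DERIV_nonneg_imp_nondecreasing[where f = "\<lambda>t. E t * exp (C * t)"])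
      show "t \<le> 0" using False by simp
    next
      fix x
      have "((\<lambda>t. E t * exp (C * t)) has_real_derivative (E' x + C * E x) * exp (C * x)) (at x)"
        by (rule derivative_eq_intros E refl | simp add: algebra_simps)+
      moreover have "(E' x + C * E x) * exp (C * x) \<ge> 0"
        using E'_bound[of x] by (intro mult_nonneg_nonneg) auto
      ultimately show "\<exists>y. ((\<lambda>t. E t * exp (C * t)) has_real_derivative y) (at x) \<and> y \<ge> 0"
        by blast
    qed
    then show ?thesis by (simp add: E0 mult_le_0_iff)
  qed
  then show ?thesis unfolding E_def by (simp only: sum_power2_le_zero_iff)
qed

lemma S1_solution_unique:
  assumes "S1_solution \<rho> y" "S1_solution \<rho> z"
  shows "y = z"
proof
  fix t
  obtain y' where y: "y 0 = 0" "y' 0 = 1" "\<And>t. (y has_real_derivative y' t) (at t)"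
      "\<And>t. \<exists>y2. (y' has_real_derivative y2) (at t) \<and> y2 + \<rho>\<^sup>2 * y' t + \<rho>\<^sup>2 * y t = 0"
    using assms(1) unfolding S1_solution_def by blast
  obtain z' where z: "z 0 = 0" "z' 0 = 1" "\<And>t. (z has_real_derivative z' t) (at t)"
      "\<And>t. \<exists>z2. (z' has_real_derivative z2) (at t) \<and> z2 + \<rho>\<^sup>2 * z' t + \<rho>\<^sup>2 * z t = 0"
    using assms(2) unfolding S1_solution_def by blast
  have "y t - z t = 0"
  proof (rule linear_ode_zero[where d = "\<lambda>t. y t - z t" and d' = "\<lambda>t. y' t - z' t" and \<rho> = \<rho>])
    fix t
    show "((\<lambda>t. y t - z t) has_real_derivative y' t - z' t) (at t)"
      by (intro DERIV_diff y z)
    obtain y2 z2 where "(y' has_real_derivative y2) (at t)" "y2 + \<rho>\<^sup>2 * y' t + \<rho>\<^sup>2 * y t = 0"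
       "(z' has_real_derivative z2) (at t)" "z2 + \<rho>\<^sup>2 * z' t + \<rho>\<^sup>2 * z t = 0"
      using y(4) z(4) by blast
    moreover from this have "y2 - z2 = - (\<rho>\<^sup>2 * (y' t - z' t)) - \<rho>\<^sup>2 * (y t - z t)"
      by (simp add: algebra_simps)
    ultimately show "((\<lambda>t. y' t - z' t) has_real_derivative
        - (\<rho>\<^sup>2 * (y' t - z' t)) - \<rho>\<^sup>2 * (y t - z t)) (at t)"
      by (metis DERIV_diff)
  qed (simp_all add: y z)
  then show "y t = z t" by simp
qed

text \<open>Uniqueness makes the description operator in \<^const>\<open>S1_hat\<close> meaningful, and the power series
  supplies the solution.\<close>
lemma S1_hat_eq_series: "S1_hat t \<rho> = exp (- t) * freq_series \<rho> 0 t"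
proof -
  let ?y = "\<lambda>t. exp (- t) * freq_series \<rho> 0 t"
  let ?y' = "\<lambda>t. exp (- t) * (freq_series \<rho> 1 t - freq_series \<rho> 0 t)"
  let ?y2 = "\<lambda>t. exp (- t) * (freq_series \<rho> 2 t - 2 * freq_series \<rho> 1 t + freq_series \<rho> 0 t)"
  note D = DERIV_freq_series[of \<rho> 0] DERIV_freq_series[of \<rho> 1]
  have init: "freq_series \<rho> k 0 = freq_coeff \<rho> k" for k
    unfolding freq_series_def using powser_zero[of "\<lambda>n. freq_coeff \<rho> (n + k) / fact n"] by simp
  have "S1_solution \<rho> ?y"
    unfolding S1_solution_def
  proof (intro conjI exI[of _ ?y'] allI)
    show "exp (- 0) * freq_series \<rho> 0 0 = 0" "exp (- 0) * (freq_series \<rho> 1 0 - freq_series \<rho> 0 0) = 1"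
      by (simp_all add: init)
    fix t
    show "(?y has_real_derivative ?y' t) (at t)"
      by (rule derivative_eq_intros D refl | simp add: algebra_simps)+
    have "?y2 t + \<rho>\<^sup>2 * ?y' t + \<rho>\<^sup>2 * ?y t = 
        exp (- t) * (freq_series \<rho> 2 t + (\<rho>\<^sup>2 - 2) * freq_series \<rho> 1 t + freq_series \<rho> 0 t)"
      by (simp add: algebra_simps)
    moreover have "(?y' has_real_derivative ?y2 t) (at t)"
      by (rule derivative_eq_intros D refl | simp add: algebra_simps numeral_2_eq_2)+
    ultimately show "\<exists>y2. (?y' has_real_derivative y2) (at t) \<and> y2 + \<rho>\<^sup>2 * ?y' t + \<rho>\<^sup>2 * ?y t = 0"
      unfolding freq_series_recurrence by auto
  qed
  then have "(THE y. S1_solution \<rho> y) = ?y"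
    using S1_solution_unique by blast
  then show ?thesis by (simp add: S1_hat_def)
qed

text \<open>The recurrence is of Chebyshev type, and Pascal's rule applied twice shows that the binomial
  sum satisfies it.  The binomial coefficients are the ones produced by the Gaussian
  moments in \<open>sin_bessel_term_integral\<close>.\<close>
lemma freq_coeff_eq_sum:
  "freq_coeff \<rho> n = (\<Sum>j\<le>n. (- 1) ^ j * \<rho> ^ (2 * j) * real ((n + j) choose (2 * j + 1)))"
proof (induction n rule: induct_nat_012)
  case (ge2 n)
  define a where "a m j = (- 1) ^ j * \<rho> ^ (2 * j) * real ((m + j) choose (2 * j + 1))" for m j :: nat
  have a0: "a m j = 0" if "j \<ge> m" for m j
    using that by (simp add: a_def binomial_eq_0)
  \<comment> \<open>The extra binomial coefficients vanish, so the three sums can share one range.\<close>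
  have extend: "(\<Sum>j\<le>m. a m j) = (\<Sum>j\<le>Suc n + 1. a m j)" if "m \<le> Suc (Suc n)" for m
    using that by (intro sum.mono_neutral_left) (auto intro: a0)
  have pascal: "a (Suc (Suc n)) (Suc j) = 2 * a (Suc n) (Suc j) - \<rho>\<^sup>2 * a (Suc n) j - a n (Suc j)" for j
  proof -
    define N where "N = n + j"
    have "real (Suc (Suc (Suc N)) choose (2 * j + 3)) = 
        2 * real (Suc (Suc N) choose (2 * j + 3)) + real (Suc N choose (2 * j + 1)) - real (Suc N choose (2 * j + 3))"
      by (simp add: numeral_3_eq_3)
    then show ?thesis
      by (simp add: a_def N_def algebra_simps power2_eq_square numeral_3_eq_3 power_add)
  qed
  have a_0: "a m 0 = real m" for m by (simp add: a_def)
  have "(2 - \<rho>\<^sup>2) * (\<Sum>j\<le>Suc n + 1. a (Suc n) j) - (\<Sum>j\<le>Suc n + 1. a n j)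
      = (\<Sum>j\<le>Suc n + 1. a (Suc (Suc n)) j)"
  proof -
    have R: "(\<Sum>j\<le>Suc n + 1. a m j) = real m + (\<Sum>j\<le>Suc n. a m (Suc j))" for m
      by (simp only: Suc_eq_plus1[symmetric] sum.atMost_Suc_shift a_0)
    have "(\<Sum>j\<le>Suc n + 1. a (Suc n) j) = (\<Sum>j\<le>Suc n. a (Suc n) j)"
      using a0[of "Suc n" "Suc n + 1"] by simp
    then have "\<rho>\<^sup>2 * (\<Sum>j\<le>Suc n + 1. a (Suc n) j) = (\<Sum>j\<le>Suc n. \<rho>\<^sup>2 * a (Suc n) j)"
      by (simp only: sum_distrib_left)
    moreover have "(\<Sum>j\<le>Suc n + 1. a (Suc (Suc n)) j) = real (Suc (Suc n)) + 
        (2 * (\<Sum>j\<le>Suc n. a (Suc n) (Suc j)) - (\<Sum>j\<le>Suc n. \<rho>\<^sup>2 * a (Suc n) j) - (\<Sum>j\<le>Suc n. a n (Suc j)))"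
      by (simp only: R pascal sum_subtractf sum_distrib_left)
    moreover have "(2 - x) * s1 - s0 = s2"
      if "x * s1 = t" "s2 = real (Suc (Suc n)) + (2 * p - t - q)" "s1 = real (Suc n) + p" "s0 = real n + q"
      for x s0 s1 s2 t p q :: real
      using that by (simp add: left_diff_distrib)
    ultimately show ?thesis
      using R[of "Suc n"] R[of n] by blast
  qed
  then have "(2 - \<rho>\<^sup>2) * (\<Sum>j\<le>Suc n. a (Suc n) j) - (\<Sum>j\<le>n. a n j) = (\<Sum>j\<le>Suc (Suc n). a (Suc (Suc n)) j)"
    using extend[of n] extend[of "Suc n"] by (metis Suc_eq_plus1 le_SucI order_refl)
  then show ?case
    unfolding freq_coeff.simps ge2 a_def .
qed (auto simp: binomial_eq_0)

section \<open>The modified Bessel series\<close>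

lemma le_exp: "x \<le> exp x" for x :: real
  by (rule order_trans[OF _ exp_ge_add_one_self]) simp

lemma power_div_fact_le_exp: "0 \<le> x \<Longrightarrow> x ^ n / fact n \<le> exp x" for x :: real
  using sum_le_suminf[OF summable_exp[of x], of "{n}"] by (simp add: exp_def field_simps)

text \<open>The function \<open>w \<mapsto> I\<^sub>0 (2 sqrt w)\<close> in terms of the modified Bessel function, which is entire.\<close>
definition bessel :: "real \<Rightarrow> real" where
  "bessel w = (\<Sum>k. w ^ k / (fact k)\<^sup>2)"

definition bessel' :: "real \<Rightarrow> real" where
  "bessel' w = (\<Sum>k. w ^ k / (fact k * fact (Suc k)))"

lemma bessel_term_le:
  fixes r u :: real
  assumes "0 \<le> r" "0 \<le> u"
  shows "(r * u) ^ k / (fact k)\<^sup>2 \<le> exp u * (inverse (fact k) * r ^ k)"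
proof -
  have "u ^ k / fact k \<le> exp u"
    using assms by (intro power_div_fact_le_exp)
  then have "u ^ k / fact k * (inverse (fact k) * r ^ k) \<le> exp u * (inverse (fact k) * r ^ k)"
    using assms by (intro mult_right_mono) auto
  then show ?thesis by (simp add: power_mult_distrib power2_eq_square field_simps)
qed

lemma summable_bessel: "summable (\<lambda>k. w ^ k / (fact k)\<^sup>2)" for w :: real
proof (rule summable_comparison_test')
  show "summable (\<lambda>k. exp 1 * (inverse (fact k) * \<bar>w\<bar> ^ k))"
    by (intro summable_mult summable_exp)
  show "norm (w ^ k / (fact k)\<^sup>2) \<le> exp 1 * (inverse (fact k) * \<bar>w\<bar> ^ k)" for k
    using bessel_term_le[of "\<bar>w\<bar>" 1 k] by (simp add: power_abs)
qed

lemma bessel'_term_le: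
  fixes w :: real
  assumes "0 \<le> w"
  shows "w ^ k / (fact k * fact (Suc k)) \<le> w ^ k / (fact k)\<^sup>2"
  unfolding power2_eq_square using assms
  by (intro divide_left_mono mult_left_mono fact_mono mult_pos_pos) auto

lemma summable_bessel': "summable (\<lambda>k. w ^ k / (fact k * fact (Suc k)))" for w :: real
proof (rule summable_comparison_test')
  show "summable (\<lambda>k. \<bar>w\<bar> ^ k / (fact k)\<^sup>2)"
    by (rule summable_bessel)
  show "norm (w ^ k / (fact k * fact (Suc k))) \<le> \<bar>w\<bar> ^ k / (fact k)\<^sup>2" for k
    using bessel'_term_le[of "\<bar>w\<bar>" k] by (simp only: real_norm_def abs_divide power_abs) simp
qed

lemma DERIV_bessel: "(bessel has_real_derivative bessel' w) (at w)"
proof -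
  have "diffs (\<lambda>k. 1 / (fact k)\<^sup>2 :: real) k = 1 / (fact k * fact (Suc k))" for k
    by (simp add: diffs_def power2_eq_square divide_simps del: of_nat_Suc)
  then show ?thesis
    using termdiffs_strong_converges_everywhere[of "\<lambda>k. 1 / (fact k)\<^sup>2" w] summable_bessel
    by (simp add: bessel_def[abs_def] bessel'_def)
qed

lemma isCont_bessel': "isCont bessel' w"
  using isCont_powser_converges_everywhere[of "\<lambda>k. 1 / (fact k * fact (Suc k))" w] summable_bessel'
  by (simp add: bessel'_def[abs_def])

text \<open>The growth is only exponential of first order in \<open>r\<close> and \<open>u\<close>, because
  \<open>(r u)\<^sup>k / k!\<^sup>2\<close> is at most \<open>exp u * r\<^sup>k / k!\<close>.  A Gaussian in \<open>r + u\<close> therefore beats it.\<close>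
lemma bessel_bounds:
  assumes "0 \<le> r" "0 \<le> u"
  shows "0 \<le> bessel (r * u)" "bessel (r * u) \<le> exp (r + u)"
    "0 \<le> bessel' (r * u)" "bessel' (r * u) \<le> exp (r + u)"
proof -
  show "0 \<le> bessel (r * u)" "0 \<le> bessel' (r * u)"
    unfolding bessel_def bessel'_def using assms
    by (auto intro!: suminf_nonneg summable_bessel summable_bessel' simp del: fact_Suc)
  have "bessel (r * u) \<le> (\<Sum>k. exp u * (inverse (fact k) * r ^ k))"
    unfolding bessel_def
    by (intro suminf_le bessel_term_le assms summable_bessel summable_mult summable_exp)
  also have "\<dots> = exp u * exp r"
    unfolding exp_def by (subst suminf_mult) (auto simp: summable_exp divide_inverse mult_ac)
  finally show b: "bessel (r * u) \<le> exp (r + u)" by (simp add: exp_add mult.commute)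
  have "bessel' (r * u) \<le> bessel (r * u)"
    unfolding bessel_def bessel'_def
    by (intro suminf_le bessel'_term_le summable_bessel summable_bessel') (use assms in auto)
  with b show "bessel' (r * u) \<le> exp (r + u)" by simp
qed

lemma borel_measurable_bessel [measurable]: "bessel \<in> borel_measurable borel"
  by (intro borel_measurable_continuous_onI continuous_at_imp_continuous_on ballI DERIV_isCont[OF DERIV_bessel])

lemma borel_measurable_bessel' [measurable]: "bessel' \<in> borel_measurable borel"
  by (intro borel_measurable_continuous_onI continuous_at_imp_continuous_on ballI isCont_bessel')

section \<open>Gaussian moments on the half-line and on the quadrant\<close>

text \<open>Normalised to have total mass one on the half-line.\<close>
definition heat :: "real \<Rightarrow> real \<Rightarrow> real" where
  "heat t x = exp (- x\<^sup>2 / (4 * t)) / sqrt (pi * t)"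

lemma borel_measurable_heat [measurable]: "heat t \<in> borel_measurable borel"
  unfolding heat_def[abs_def] by measurable

lemma heat_nonneg: "0 < t \<Longrightarrow> 0 \<le> heat t x"
  by (simp add: heat_def)

text \<open>Completing the square in the exponent.\<close>
lemma exp_heat_le:
  assumes "0 < t"
  shows "exp (\<alpha> * x) * heat t x \<le> exp (\<alpha>\<^sup>2 * t) / sqrt (pi * t)"
proof -
  have "0 \<le> (x - 2 * \<alpha> * t)\<^sup>2 / (4 * t)" using assms by simp
  also have "\<dots> = \<alpha>\<^sup>2 * t - (\<alpha> * x - x\<^sup>2 / (4 * t))"
    using assms by (simp add: power2_eq_square field_simps)
  finally have "exp (\<alpha> * x - x\<^sup>2 / (4 * t)) \<le> exp (\<alpha>\<^sup>2 * t)" by simp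
  then show ?thesis
    using assms by (simp add: heat_def exp_add[symmetric] divide_right_mono)
qed

text \<open>Averaging over \<^const>\<open>heat\<close> turns \<open>x\<^sup>2\<^sup>m / (2m)!\<close> into \<open>t\<^sup>m / m!\<close>.  On the level of Laplace
  transforms this replaces \<open>q\<close> by \<open>sqrt p\<close>, which is how the square roots in the formula for the
  profile arise from entire functions.\<close>
lemma heat_moment_half_line:
  assumes "0 < t"
  shows "has_bochner_integral lborel (\<lambda>x. indicator {0..} x * (x ^ (2 * m) * heat t x))
           (fact (2 * m) / fact m * t ^ m)"
proof -
  let ?c = "1 / (2 * sqrt t)"
  have c: "?c \<noteq> 0" "0 < ?c" using assms by auto
  have c2: "?c\<^sup>2 = 1 / (4 * t)" using assms by (simp add: power_divide power_mult_distrib)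
  have "has_bochner_integral lborel (\<lambda>x. indicator {0..} (0 + ?c * x) *\<^sub>R (exp (- (0 + ?c * x)\<^sup>2) * (0 + ?c * x) ^ (2 * m)))
     ((sqrt pi / 2 * (fact (2 * m) / (2 ^ (2 * m) * fact m))) /\<^sub>R \<bar>?c\<bar>)"
    by (subst lborel_has_bochner_integral_real_affine_iff[OF c(1), symmetric])
      (rule gaussian_moment_even_pos)
  then have "has_bochner_integral lborel
     (\<lambda>x. (4 ^ m * t ^ m / sqrt (pi * t)) * (indicator {0..} (0 + ?c * x) *\<^sub>R (exp (- (0 + ?c * x)\<^sup>2) * (0 + ?c * x) ^ (2 * m))))
     ((4 ^ m * t ^ m / sqrt (pi * t)) * ((sqrt pi / 2 * (fact (2 * m) / (2 ^ (2 * m) * fact m))) /\<^sub>R \<bar>?c\<bar>))"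
    by (rule has_bochner_integral_mult_right)
  moreover have "(4 ^ m * t ^ m / sqrt (pi * t)) * (indicator {0..} (0 + ?c * x) *\<^sub>R (exp (- (0 + ?c * x)\<^sup>2) * (0 + ?c * x) ^ (2 * m)))
      = indicator {0..} x * (x ^ (2 * m) * heat t x)" for x
  proof -
    have "(indicator {0..} (0 + ?c * x) :: real) = indicator {0..} x"
      using c by (auto simp: indicator_def zero_le_divide_iff)
    moreover have "(0 + ?c * x) ^ (2 * m) = x ^ (2 * m) / (4 * t) ^ m"
      unfolding power_mult add_0 power_mult_distrib[of ?c x 2] c2 by (simp add: power_mult_distrib power_divide)
    moreover have "(0 + ?c * x)\<^sup>2 = x\<^sup>2 / (4 * t)"
      unfolding add_0 power_mult_distrib[of ?c x 2] c2 by simp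
    ultimately show ?thesis
      using assms by (simp add: heat_def power_mult_distrib)
  qed
  moreover have "(4 ^ m * t ^ m / sqrt (pi * t)) * ((sqrt pi / 2 * (fact (2 * m) / (2 ^ (2 * m) * fact m))) /\<^sub>R \<bar>?c\<bar>)
      = fact (2 * m) / fact m * t ^ m"
  proof -
    have "(q * T / (p * s)) * (2 * s * (p / 2 * (F2 / (q * F)))) = F2 / F * T"
      if "q \<noteq> 0" "p \<noteq> 0" "s \<noteq> 0" for q p s T F F2 :: real
      using that by simp
    from this[of "4 ^ m" "sqrt pi" "sqrt t" "t ^ m" "fact (2 * m)" "fact m"] show ?thesis
      using assms by (simp add: real_sqrt_mult power_mult)
  qed
  ultimately show ?thesis by simp
qed

text \<open>In the variables \<open>x = r + u\<close> and \<open>r\<close> the inner integral is the convolution of the monomials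
  \<open>r\<^sup>a / a!\<close> and \<open>u\<^sup>b / b!\<close>, that is \<open>x\<^sup>a\<^sup>+\<^sup>b\<^sup>+\<^sup>1 / (a + b + 1)!\<close>.  The convolution is read off from the
  one for Erlang densities of rate one, whose factors \<open>exp (- r)\<close> and \<open>exp (- u)\<close> are compensated
  by \<open>exp (r + u)\<close>.\<close>
lemma heat_moment_quadrant:
  assumes t: "0 < t" and ab: "a + b + 1 = 2 * m"
  shows "has_bochner_integral (lborel \<Otimes>\<^sub>M lborel)
     (\<lambda>(r, u). if 0 \<le> r \<and> 0 \<le> u then r ^ a / fact a * (u ^ b / fact b) * heat t (r + u) else 0)
     (t ^ m / fact m)"
proof (rule has_bochner_integral_nn_integral)
  let ?E = "\<lambda>k. erlang_density k (1::real)"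
  let ?H = "\<lambda>x. exp x * heat t x"
  let ?F = "\<lambda>(r, u). if 0 \<le> r \<and> 0 \<le> u then r ^ a / fact a * (u ^ b / fact b) * heat t (r + u) else 0"
  have F: "?F (r, u) = ?E a r * ?E b u * ?H (r + u)" for r u :: real
    by (auto simp: erlang_density_def exp_add exp_minus field_simps)
  note [measurable] = borel_measurable_erlang_density
  have "(\<integral>\<^sup>+ p. ennreal (?F p) \<partial>(lborel \<Otimes>\<^sub>M lborel)) = (\<integral>\<^sup>+ r. \<integral>\<^sup>+ u. ennreal (?F (r, u)) \<partial>lborel \<partial>lborel)"
    by (rule lborel.nn_integral_fst[symmetric]) measurable
  also have "\<dots> = (\<integral>\<^sup>+ r. \<integral>\<^sup>+ x. ennreal (?E a r * ?E b (- r + 1 * x) * ?H (r + (- r + 1 * x))) \<partial>lborel \<partial>lborel)"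
  proof (rule nn_integral_cong)
    fix r :: real
    show "(\<integral>\<^sup>+ u. ennreal (?F (r, u)) \<partial>lborel) = (\<integral>\<^sup>+ x. ennreal (?E a r * ?E b (- r + 1 * x) * ?H (r + (- r + 1 * x))) \<partial>lborel)"
      unfolding F by (subst nn_integral_real_affine[where c = 1 and t = "- r"]) simp_all
  qed
  also have "\<dots> = (\<integral>\<^sup>+ x. \<integral>\<^sup>+ r. ennreal (?E a r * ?E b (- r + 1 * x) * ?H (r + (- r + 1 * x))) \<partial>lborel \<partial>lborel)"
    by (rule lborel_pair.Fubini'[symmetric]) measurable
  also have "\<dots> = (\<integral>\<^sup>+ x. ennreal (?H x) * (\<integral>\<^sup>+ r. ennreal (?E b (x - r)) * ennreal (?E a r) \<partial>lborel) \<partial>lborel)"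
    by (intro nn_integral_cong, subst nn_integral_cmult[symmetric])
      (auto intro!: nn_integral_cong simp: ennreal_mult''[symmetric] heat_nonneg t mult_ac)
  also have "\<dots> = (\<integral>\<^sup>+ x. ennreal (?H x) * ennreal (?E (2 * m) x) \<partial>lborel)"
    using ab by (subst convolution_erlang_density[THEN fun_cong]) (auto simp: add_ac)
  also have "\<dots> = (\<integral>\<^sup>+ x. ennreal ((1 / fact (2 * m)) * (indicator {0..} x * (x ^ (2 * m) * heat t x))) \<partial>lborel)"
    by (intro nn_integral_cong)
       (auto simp: erlang_density_def ennreal_mult''[symmetric] exp_minus indicator_def heat_nonneg t field_simps)
  also have "\<dots> = ennreal ((1 / fact (2 * m)) * (fact (2 * m) / fact m * t ^ m))"
    using has_bochner_integral_mult_right[OF heat_moment_half_line[OF t, of m], of "1 / fact (2 * m)"] t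
    by (subst nn_integral_eq_integral) (auto simp: has_bochner_integral_iff heat_nonneg indicator_def)
  finally show "(\<integral>\<^sup>+ p. ennreal (?F p) \<partial>(lborel \<Otimes>\<^sub>M lborel)) = ennreal (t ^ m / fact m)"
    by simp
qed (use t in \<open>auto simp: heat_nonneg\<close>)

section \<open>The positive profile\<close>

lemma integrable_exp_minus_half_line: "integrable lborel (\<lambda>x::real. if 0 \<le> x then exp (- x) else 0)"
proof -
  have "(\<lambda>x::real. x ^ 0 * exp (- x) * indicator {0..} x) = (\<lambda>x. if 0 \<le> x then exp (- x) else 0)"
    by (auto simp: fun_eq_iff indicator_def)
  then show ?thesis
    using has_bochner_integral_I0i_power_exp_m'[of 0] by (simp only: has_bochner_integral_iff)
qed

lemma integrable_product_real:
  fixes f g :: "real \<Rightarrow> real"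
  assumes f: "integrable lborel f" and g: "integrable lborel g"
  shows "integrable (lborel \<Otimes>\<^sub>M lborel) (\<lambda>(x, y). f x * g y)"
proof (rule lborel_pair.Fubini_integrable)
  have [measurable]: "f \<in> borel_measurable borel" "g \<in> borel_measurable borel"
    using f g by auto
  show "(\<lambda>(x, y). f x * g y) \<in> borel_measurable (lborel \<Otimes>\<^sub>M lborel)"
    by measurable
  show "integrable lborel (\<lambda>x. LINT y|lborel. norm (case (x, y) of (x, y) \<Rightarrow> f x * g y))"
    using f by (simp add: abs_mult)
  show "AE x in lborel. integrable lborel (\<lambda>y. case (x, y) of (x, y) \<Rightarrow> f x * g y)"
    using g by simp
qed

text \<open>All kernels below decay like \<open>exp (- (r + u))\<close>, a product of two integrable functions, so one
  majorant serves for all of them.\<close>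
lemma integrable_quadrant_bound:
  fixes f :: "real \<Rightarrow> real \<Rightarrow> real"
  assumes [measurable]: "case_prod f \<in> borel_measurable (borel \<Otimes>\<^sub>M borel)"
    and bound: "\<And>r u. \<bar>f r u\<bar> \<le> (if 0 \<le> r \<and> 0 \<le> u then C * exp (- (r + u)) else 0)"
  shows "integrable (lborel \<Otimes>\<^sub>M lborel) (case_prod f)"
proof (rule Bochner_Integration.integrable_bound)
  let ?e = "\<lambda>x::real. if 0 \<le> x then exp (- x) else 0"
  show "integrable (lborel \<Otimes>\<^sub>M lborel) (\<lambda>p. C * (case p of (r, u) \<Rightarrow> ?e r * ?e u))"
    by (intro integrable_mult_right integrable_product_real integrable_exp_minus_half_line)
  have "norm (f r u) \<le> norm (C * (?e r * ?e u))" for r u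
    using bound[of r u] order_trans[OF _ mult_right_mono[OF abs_ge_self[of C], of "exp (- (r + u))"]]
    by (auto simp: abs_mult exp_add[symmetric] split: if_splits)
  then show "AE p in lborel \<Otimes>\<^sub>M lborel. norm (case_prod f p) \<le> norm (C * (case p of (r, u) \<Rightarrow> ?e r * ?e u))"
    by (intro AE_I2) (auto simp: split_beta)
  show "case_prod f \<in> borel_measurable (lborel \<Otimes>\<^sub>M lborel)" by measurable
qed

definition wave_kernel :: "real \<Rightarrow> real \<Rightarrow> real \<Rightarrow> real" where
  "wave_kernel t r u = (if 0 \<le> r \<and> 0 \<le> u then bessel (r * u) * heat t (r + u) else 0)"

text \<open>The function \<open>\<Phi>\<close> of the introduction.\<close>
definition profile :: "real \<Rightarrow> real \<Rightarrow> real" where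
  "profile t r = (LINT u|lborel. wave_kernel t r u)"

lemma borel_measurable_kernel [measurable]: "case_prod (wave_kernel t) \<in> borel_measurable (borel \<Otimes>\<^sub>M borel)"
  unfolding wave_kernel_def[abs_def] by measurable

lemma borel_measurable_profile [measurable]: "profile t \<in> borel_measurable borel"
  unfolding profile_def[abs_def] by measurable

lemma exp_heat_decay:
  assumes "0 < t" "0 \<le> c"
  obtains C where "\<And>x. exp (c * x) * heat t x \<le> C * exp (- x)"
proof
  fix x
  have "exp (c * x) * heat t x = exp ((c + 1) * x) * heat t x * exp (- x)"
    by (simp add: exp_add[symmetric] algebra_simps)
  also have "\<dots> \<le> exp ((c + 1)\<^sup>2 * t) / sqrt (pi * t) * exp (- x)"
    by (intro mult_right_mono exp_heat_le assms) simp
  finally show "exp (c * x) * heat t x \<le> exp ((c + 1)\<^sup>2 * t) / sqrt (pi * t) * exp (- x)" .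
qed

lemma wave_kernel_nonneg: "0 < t \<Longrightarrow> 0 \<le> wave_kernel t r u"
  by (auto simp: wave_kernel_def heat_nonneg bessel_bounds)

lemma wave_kernel_le: "0 < t \<Longrightarrow> wave_kernel t r u \<le> (if 0 \<le> r \<and> 0 \<le> u then exp (r + u) * heat t (r + u) else 0)"
  by (auto simp: wave_kernel_def heat_nonneg bessel_bounds intro!: mult_right_mono)

text \<open>The free factor \<open>exp (c * r)\<close> leaves room for weights such as the factor \<open>r\<close>, whose
  integrability against the profile Fubini's theorem requires later.\<close>
lemma wave_kernel_decay:
  assumes "0 < t" "0 \<le> c"
  obtains C where "\<And>r u. exp (c * r) * wave_kernel t r u \<le> (if 0 \<le> r \<and> 0 \<le> u then C * exp (- (r + u)) else 0)"
proof -
  obtain C where C: "\<And>x. exp ((c + 1) * x) * heat t x \<le> C * exp (- x)"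
    using exp_heat_decay[of t "c + 1"] assms by auto
  show ?thesis
  proof (rule that[of C])
    fix r u :: real
    show "exp (c * r) * wave_kernel t r u \<le> (if 0 \<le> r \<and> 0 \<le> u then C * exp (- (r + u)) else 0)"
    proof (cases "0 \<le> r \<and> 0 \<le> u")
      case True
      have "exp (c * r) * wave_kernel t r u \<le> exp (c * (r + u)) * (exp (r + u) * heat t (r + u))"
        using wave_kernel_le[of t r u] True assms wave_kernel_nonneg[of t r u]
        by (intro mult_mono) (auto intro!: mult_left_mono)
      also have "\<dots> = exp ((c + 1) * (r + u)) * heat t (r + u)"
        by (simp add: exp_add[symmetric] algebra_simps)
      finally show ?thesis using C[of "r + u"] True by auto
    next
      case False
      then show ?thesis by (auto simp: wave_kernel_def)
    qed
  qed
qed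

lemma integrable_mult_kernel:
  assumes t: "0 < t" and c: "0 \<le> c" and [measurable]: "h \<in> borel_measurable borel"
    and h: "\<And>r. 0 \<le> r \<Longrightarrow> \<bar>h r\<bar> \<le> exp (c * r)"
  shows "integrable (lborel \<Otimes>\<^sub>M lborel) (\<lambda>(r, u). h r * wave_kernel t r u)"
proof -
  obtain C where C: "\<And>r u. exp (c * r) * wave_kernel t r u \<le> (if 0 \<le> r \<and> 0 \<le> u then C * exp (- (r + u)) else 0)"
    using wave_kernel_decay[OF t c] by metis
  show ?thesis
  proof (rule integrable_quadrant_bound[where f = "\<lambda>r u. h r * wave_kernel t r u" and C = C])
    fix r u :: real
    show "\<bar>h r * wave_kernel t r u\<bar> \<le> (if 0 \<le> r \<and> 0 \<le> u then C * exp (- (r + u)) else 0)"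
    proof (cases "0 \<le> r \<and> 0 \<le> u")
      case True
      then have "\<bar>h r * wave_kernel t r u\<bar> \<le> exp (c * r) * wave_kernel t r u"
        using h[of r] wave_kernel_nonneg[OF t, of r u] by (simp add: abs_mult mult_right_mono)
      then show ?thesis using C[of r u] by linarith
    next
      case False
      then show ?thesis by (auto simp: wave_kernel_def)
    qed
  qed measurable
qed

lemma integral_mult_kernel:
  assumes "0 < t" "0 \<le> c" "h \<in> borel_measurable borel" "\<And>r. 0 \<le> r \<Longrightarrow> \<bar>h r\<bar> \<le> exp (c * r)"
  shows "integrable lborel (\<lambda>r. h r * profile t r)"
    and "(LINT p|(lborel \<Otimes>\<^sub>M lborel). (case p of (r, u) \<Rightarrow> h r * wave_kernel t r u)) = (LINT r|lborel. h r * profile t r)"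
  using lborel_pair.integrable_fst'[OF integrable_mult_kernel[OF assms]]
    lborel_pair.integral_fst'[OF integrable_mult_kernel[OF assms]]
  by (simp_all add: profile_def)

lemma profile_nonneg: "0 < t \<Longrightarrow> 0 \<le> profile t r"
  unfolding profile_def by (intro integral_nonneg_AE AE_I2 wave_kernel_nonneg)

lemma profile_negative: "r < 0 \<Longrightarrow> profile t r = 0"
  by (simp add: profile_def wave_kernel_def)

section \<open>The solution as a sine transform of the profile\<close>

text \<open>The terms of the Cauchy product of the series of \<open>sin (\<rho> * r)\<close> and \<open>bessel (r * u)\<close>.  The
  \<open>m\<close>-th term is homogeneous of degree \<open>2 m + 1\<close> in \<open>r\<close> and \<open>u\<close>, so its integral against \<^const>\<open>heat\<close>
  is a multiple of the single power \<open>t ^ Suc m\<close>.\<close>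
definition sin_bessel_term :: "real \<Rightarrow> real \<Rightarrow> real \<Rightarrow> nat \<Rightarrow> real" where
  "sin_bessel_term \<rho> r u m = (\<Sum>j\<le>m. ((- 1) ^ j / fact (2 * j + 1) * (\<rho> * r) ^ (2 * j + 1)) *
      ((r * u) ^ (m - j) / (fact (m - j))\<^sup>2))"

text \<open>The majorant of the partial sums must not grow faster than an exponential of \<open>r + u\<close>, otherwise the
  Gaussian would not dominate it; it is obtained by comparing the absolute series of the sine with
  the odd part of the exponential series.\<close>
lemma sin_bessel_sums:
  assumes "0 \<le> r" "0 \<le> u"
  shows "sin_bessel_term \<rho> r u sums (sin (\<rho> * r) * bessel (r * u))"
    and "\<bar>\<Sum>m<n. sin_bessel_term \<rho> r u m\<bar> \<le> exp (\<bar>\<rho>\<bar> * r) * exp (r + u)"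
proof -
  let ?a = "\<lambda>j. (- 1) ^ j / fact (2 * j + 1) * (\<rho> * r) ^ (2 * j + 1)"
  let ?b = "\<lambda>k. (r * u) ^ k / (fact k)\<^sup>2"
  have a_abs: "norm (?a j) = inverse (fact (2 * j + 1)) * (\<bar>\<rho>\<bar> * r) ^ (2 * j + 1)" for j
    using assms by (simp only: real_norm_def abs_mult abs_divide power_abs divide_inverse) simp
  have b_nonneg: "0 \<le> ?b k" for k using assms by simp
  have partial: "(\<Sum>j<n. norm (?a j)) \<le> exp (\<bar>\<rho>\<bar> * r)" for n
  proof -
    have "(\<Sum>j<n. norm (?a j)) = (\<Sum>i\<in>(\<lambda>j. 2 * j + 1) ` {..<n}. inverse (fact i) * (\<bar>\<rho>\<bar> * r) ^ i)"
      unfolding a_abs by (subst sum.reindex) (auto simp: inj_on_def)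
    also have "\<dots> \<le> (\<Sum>i. inverse (fact i) * (\<bar>\<rho>\<bar> * r) ^ i)"
      using assms by (intro sum_le_suminf summable_exp) auto
    also have "\<dots> = exp (\<bar>\<rho>\<bar> * r)" by (simp add: exp_def divide_inverse mult_ac)
    finally show ?thesis .
  qed
  have sum_a: "summable (\<lambda>j. norm (?a j))"
    by (rule summableI_nonneg_bounded[of _ "exp (\<bar>\<rho>\<bar> * r)"]) (use partial in auto)
  have sum_b: "summable (\<lambda>k. norm (?b k))" using summable_bessel[of "r * u"] by (simp only: real_norm_def abs_of_nonneg[OF b_nonneg])
  show "sin_bessel_term \<rho> r u sums (sin (\<rho> * r) * bessel (r * u))"
    using Cauchy_product_sums[OF sum_a sum_b] sin_paired[of "\<rho> * r"]
    by (simp only: sin_bessel_term_def[abs_def] bessel_def sums_iff)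
  have "\<bar>\<Sum>m<n. sin_bessel_term \<rho> r u m\<bar> \<le> (\<Sum>m<n. \<Sum>j\<le>m. norm (?a j) * norm (?b (m - j)))"
    unfolding sin_bessel_term_def
    by (intro order_trans[OF sum_abs] sum_mono order_trans[OF sum_abs]) (simp only: abs_mult real_norm_def order_refl)
  also have "\<dots> \<le> (\<Sum>m. \<Sum>j\<le>m. norm (?a j) * norm (?b (m - j)))"
    using Cauchy_product_sums[of "\<lambda>j. norm (?a j)" "\<lambda>k. norm (?b k)"] sum_a sum_b
    by (intro sum_le_suminf) (auto simp: sums_iff intro!: sum_nonneg)
  also have "\<dots> = (\<Sum>j. norm (?a j)) * (\<Sum>k. norm (?b k))"
    using Cauchy_product[of "\<lambda>j. norm (?a j)" "\<lambda>k. norm (?b k)"] sum_a sum_b by simp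
  also have "\<dots> \<le> exp (\<bar>\<rho>\<bar> * r) * bessel (r * u)"
    using suminf_le_const[OF sum_a partial] b_nonneg assms
    by (intro mult_mono) (auto simp: bessel_def intro!: suminf_nonneg summable_bessel sum_b)
  also have "\<dots> \<le> exp (\<bar>\<rho>\<bar> * r) * exp (r + u)"
    using assms by (intro mult_left_mono bessel_bounds) auto
  finally show "\<bar>\<Sum>m<n. sin_bessel_term \<rho> r u m\<bar> \<le> exp (\<bar>\<rho>\<bar> * r) * exp (r + u)" .
qed

lemma sin_bessel_term_integral:
  assumes t: "0 < t"
  shows "has_bochner_integral (lborel \<Otimes>\<^sub>M lborel)
      (\<lambda>(r, u). if 0 \<le> r \<and> 0 \<le> u then sin_bessel_term \<rho> r u m * heat t (r + u) else 0)
      (\<rho> * (freq_coeff \<rho> (Suc m) / fact (Suc m) * t ^ Suc m))"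
proof -
  define c where "c j = (- 1) ^ j * \<rho> ^ (2 * j + 1) * real ((Suc m + j) choose (2 * j + 1))" for j
  define M where "M j = (\<lambda>(r, u). if 0 \<le> r \<and> 0 \<le> u
    then r ^ (m + j + 1) / fact (m + j + 1) * (u ^ (m - j) / fact (m - j)) * heat t (r + u) else 0)" for j
  define T where "T = t ^ Suc m / fact (Suc m)"
  have "has_bochner_integral (lborel \<Otimes>\<^sub>M lborel) (M j) T" if "j \<le> m" for j
    unfolding M_def T_def by (rule heat_moment_quadrant[OF t]) (use that in simp)
  then have "has_bochner_integral (lborel \<Otimes>\<^sub>M lborel) (\<lambda>p. \<Sum>j\<le>m. c j * M j p) (\<Sum>j\<le>m. c j * T)"
    by (intro has_bochner_integral_sum has_bochner_integral_mult_right) auto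
  moreover have "(\<Sum>j\<le>m. c j * M j p) =
      (case p of (r, u) \<Rightarrow> if 0 \<le> r \<and> 0 \<le> u then sin_bessel_term \<rho> r u m * heat t (r + u) else 0)" for p
  proof (cases p)
    case (Pair r u)
    have "c j * (r ^ (m + j + 1) / fact (m + j + 1) * (u ^ (m - j) / fact (m - j))) =
       ((- 1) ^ j / fact (2 * j + 1) * (\<rho> * r) ^ (2 * j + 1)) * ((r * u) ^ (m - j) / (fact (m - j))\<^sup>2)"
      if "j \<le> m" for j
    proof -
      have b: "real ((Suc m + j) choose (2 * j + 1)) = fact (m + j + 1) / (fact (2 * j + 1) * fact (m - j))"
        using that by (subst binomial_fact) (simp_all add: mult_2 del: fact_Suc)
      have r: "r ^ (m + j + 1) = r ^ (2 * j + 1) * r ^ (m - j)"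
        using that by (simp only: power_add[symmetric]) (simp add: mult_2 add_ac)
      have "s * \<rho>' * (f1 / (f2 * f3)) * (r1 * r2 / f1 * (u1 / f3)) = s / f2 * (\<rho>' * r1) * (r2 * u1 / (f3 * f3))"
        if "f1 \<noteq> 0" for s \<rho>' f1 f2 f3 r1 r2 u1 :: real
        using that by simp
      then show ?thesis
        unfolding c_def b r power_mult_distrib power2_eq_square by (meson fact_nonzero)
    qed
    then have "(\<Sum>j\<le>m. c j * (r ^ (m + j + 1) / fact (m + j + 1) * (u ^ (m - j) / fact (m - j)))) = sin_bessel_term \<rho> r u m"
      unfolding sin_bessel_term_def by (intro sum.cong) auto
    moreover have "(\<Sum>j\<le>m. c j * M j p) = (if 0 \<le> r \<and> 0 \<le> u
        then (\<Sum>j\<le>m. c j * (r ^ (m + j + 1) / fact (m + j + 1) * (u ^ (m - j) / fact (m - j)))) * heat t (r + u) else 0)"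
      by (cases "0 \<le> r \<and> 0 \<le> u")
        (simp_all only: Pair M_def prod.case sum_distrib_right mult.assoc if_True if_False mult_zero_right sum.neutral_const simp_thms)
    ultimately show ?thesis by (simp only: Pair prod.case)
  qed
  moreover have "(\<Sum>j\<le>m. c j * T) = \<rho> * (freq_coeff \<rho> (Suc m) / fact (Suc m) * t ^ Suc m)"
  proof -
    have "freq_coeff \<rho> (Suc m) = (\<Sum>j\<le>m. (- 1) ^ j * \<rho> ^ (2 * j) * real ((Suc m + j) choose (2 * j + 1)))"
      unfolding freq_coeff_eq_sum sum.atMost_Suc
      by (subst binomial_eq_0[of "Suc m + Suc m" "2 * Suc m + 1"]) (simp_all only: mult_zero_right add_0_right of_nat_0, simp)
    then have "\<rho> * freq_coeff \<rho> (Suc m) = (\<Sum>j\<le>m. c j)"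
      by (simp only: sum_distrib_left c_def power_add power_one_right mult_ac)
    then show ?thesis
      unfolding sum_distrib_right[symmetric] T_def by (metis mult.assoc times_divide_eq_left times_divide_eq_right)
  qed
  ultimately show ?thesis by (simp only:)
qed

text \<open>Both sides have the same expansion in powers of \<open>t\<close>; dominated convergence allows the
  term by term integration.\<close>
theorem freq_series_eq_sine_transform:
  assumes t: "0 < t"
  shows "\<rho> * freq_series \<rho> 0 t = (LINT r|lborel. sin (\<rho> * r) * profile t r)"
proof -
  let ?P = "lborel \<Otimes>\<^sub>M lborel :: (real \<times> real) measure"
  let ?S = "\<lambda>n (r, u). if 0 \<le> r \<and> 0 \<le> u then (\<Sum>m<n. sin_bessel_term \<rho> r u m) * heat t (r + u) else 0"
  have sin_le: "\<bar>sin (\<rho> * r)\<bar> \<le> exp (0 * r)" for r by simp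
  obtain C where C: "\<And>x. exp ((\<bar>\<rho>\<bar> + 1) * x) * heat t x \<le> C * exp (- x)"
    using exp_heat_decay[of t "\<bar>\<rho>\<bar> + 1"] t by auto
  have S: "has_bochner_integral ?P (?S n) (\<Sum>m<n. \<rho> * (freq_coeff \<rho> (Suc m) / fact (Suc m) * t ^ Suc m))" for n
  proof -
    have "has_bochner_integral ?P (\<lambda>p. \<Sum>m<n. (case p of (r, u) \<Rightarrow> if 0 \<le> r \<and> 0 \<le> u then sin_bessel_term \<rho> r u m * heat t (r + u) else 0))
      (\<Sum>m<n. \<rho> * (freq_coeff \<rho> (Suc m) / fact (Suc m) * t ^ Suc m))"
      by (intro has_bochner_integral_sum sin_bessel_term_integral t)
    moreover have "(\<Sum>m<n. (case p of (r, u) \<Rightarrow> if 0 \<le> r \<and> 0 \<le> u then sin_bessel_term \<rho> r u m * heat t (r + u) else 0)) = ?S n p" for p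
      by (auto simp: split_beta sum_distrib_right)
    ultimately show ?thesis by (simp only:)
  qed
  have "(\<lambda>n. integral\<^sup>L ?P (?S n)) \<longlonglongrightarrow> (LINT p|?P. (case p of (r, u) \<Rightarrow> sin (\<rho> * r) * wave_kernel t r u))"
  proof (rule integral_dominated_convergence[where s = ?S and f = "\<lambda>(r, u). sin (\<rho> * r) * wave_kernel t r u"
        and w = "\<lambda>(r, u). if 0 \<le> r \<and> 0 \<le> u then C * exp (- (r + u)) else 0"])
    show "integrable ?P (\<lambda>(r, u). if 0 \<le> r \<and> 0 \<le> u then C * exp (- (r + u)) else 0)"
    proof (rule integrable_quadrant_bound[where C = "\<bar>C\<bar>"])
    qed (auto simp: abs_mult)
    show "(\<lambda>(r, u). sin (\<rho> * r) * wave_kernel t r u) \<in> borel_measurable ?P" by measurable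
    show "?S n \<in> borel_measurable ?P" for n
      using S[of n] by (rule has_bochner_integral_iff[THEN iffD1, THEN conjunct1, THEN borel_measurable_integrable])
    show "AE p in ?P. (\<lambda>n. ?S n p) \<longlonglongrightarrow> (case p of (r, u) \<Rightarrow> sin (\<rho> * r) * wave_kernel t r u)"
    proof (rule AE_I2, unfold split_paired_all)
      fix r u :: real
      show "(\<lambda>n. ?S n (r, u)) \<longlonglongrightarrow> (case (r, u) of (r, u) \<Rightarrow> sin (\<rho> * r) * wave_kernel t r u)"
      proof (cases "0 \<le> r \<and> 0 \<le> u")
        case True
        then show ?thesis
          using tendsto_mult_right[OF sin_bessel_sums(1)[of r u \<rho>, unfolded sums_def], of "heat t (r + u)"]
          by (simp add: wave_kernel_def mult.assoc)
      next
        case False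
        then show ?thesis by (auto simp: wave_kernel_def)
      qed
    qed
    show "AE p in ?P. norm (?S n p) \<le> (case p of (r, u) \<Rightarrow> if 0 \<le> r \<and> 0 \<le> u then C * exp (- (r + u)) else 0)" for n
    proof (rule AE_I2, unfold split_paired_all)
      fix r u :: real
      show "norm (?S n (r, u)) \<le> (case (r, u) of (r, u) \<Rightarrow> if 0 \<le> r \<and> 0 \<le> u then C * exp (- (r + u)) else 0)"
      proof (cases "0 \<le> r \<and> 0 \<le> u")
        case True
        have "\<bar>\<Sum>m<n. sin_bessel_term \<rho> r u m\<bar> * heat t (r + u) \<le> exp (\<bar>\<rho>\<bar> * r) * exp (r + u) * heat t (r + u)"
          using True sin_bessel_sums(2)[of r u \<rho> n] heat_nonneg[OF t] by (intro mult_right_mono) auto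
        also have "\<dots> \<le> exp (\<bar>\<rho>\<bar> * (r + u)) * exp (r + u) * heat t (r + u)"
          using True heat_nonneg[OF t] by (intro mult_right_mono) (auto intro!: mult_left_mono)
        also have "\<dots> = exp ((\<bar>\<rho>\<bar> + 1) * (r + u)) * heat t (r + u)"
          by (simp add: exp_add[symmetric] algebra_simps)
        finally show ?thesis
          using True C[of "r + u"] heat_nonneg[OF t, of "r + u"] by (simp add: abs_mult)
      next
        case False
        then show ?thesis by auto
      qed
    qed
  qed
  then have "(\<lambda>n. \<Sum>m<n. \<rho> * (freq_coeff \<rho> (Suc m) / fact (Suc m) * t ^ Suc m)) \<longlonglongrightarrow> (LINT r|lborel. sin (\<rho> * r) * profile t r)"
    using has_bochner_integral_integral_eq[OF S] integral_mult_kernel(2)[OF t order_refl, of "\<lambda>r. sin (\<rho> * r)"] sin_le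
    by simp
  moreover have "(\<lambda>m. \<rho> * (freq_coeff \<rho> (Suc m) / fact (Suc m) * t ^ Suc m)) sums (\<rho> * freq_series \<rho> 0 t)"
  proof (rule sums_mult)
    show "(\<lambda>m. freq_coeff \<rho> (Suc m) / fact (Suc m) * t ^ Suc m) sums freq_series \<rho> 0 t"
      using summable_sums[OF summable_freq_series[of \<rho> 0 t]]
      by (subst sums_Suc_iff) (simp add: freq_series_def)
  qed
  ultimately show ?thesis
    unfolding sums_def by (rule LIMSEQ_unique[OF _ _, symmetric])
qed

section \<open>The profile as a tail integral\<close>

text \<open>On the quadrant, minus the derivative of \<^const>\<open>wave_kernel\<close> in its first spatial argument.\<close>
definition slope :: "real \<Rightarrow> real \<Rightarrow> real \<Rightarrow> real" where
  "slope t v u = (if 0 \<le> v \<and> 0 \<le> u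
     then ((v + u) / (2 * t) * bessel (v * u) - u * bessel' (v * u)) * heat t (v + u) else 0)"

text \<open>Formally minus the derivative of \<^const>\<open>profile\<close>; \<open>profile_eq_tail\<close> says so in integrated form.\<close>
definition decay_rate :: "real \<Rightarrow> real \<Rightarrow> real" where
  "decay_rate t v = (LINT u|lborel. slope t v u)"

lemma borel_measurable_slope [measurable]: "case_prod (slope t) \<in> borel_measurable (borel \<Otimes>\<^sub>M borel)"
  unfolding slope_def[abs_def] by measurable

text \<open>The polynomial factor is absorbed by one exponential, which together with the growth of the
  Bessel series and the weight \<open>exp v\<close> gives \<open>exp (3 * (v + u))\<close>, and the Gaussian beats that.\<close>
lemma slope_decay:
  assumes t: "0 < t"
  obtains C where "\<And>v u. exp v * \<bar>slope t v u\<bar> \<le> (if 0 \<le> v \<and> 0 \<le> u then C * exp (- (v + u)) else 0)"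
proof -
  obtain C where C: "\<And>x. exp (3 * x) * heat t x \<le> C * exp (- x)"
    using exp_heat_decay[of t 3] t by auto
  define K where "K = 1 / (2 * t) + 1"
  have K: "0 \<le> K" using t by (simp add: K_def)
  show ?thesis
  proof (rule that[of "K * C"])
    fix v u :: real
    show "exp v * \<bar>slope t v u\<bar> \<le> (if 0 \<le> v \<and> 0 \<le> u then K * C * exp (- (v + u)) else 0)"
    proof (cases "0 \<le> v \<and> 0 \<le> u")
      case True
      let ?x = "v + u"
      note b = bessel_bounds[of v u]
      have "\<bar>?x / (2 * t) * bessel (v * u) - u * bessel' (v * u)\<bar> \<le> \<bar>?x / (2 * t) * bessel (v * u)\<bar> + \<bar>u * bessel' (v * u)\<bar>"
        by (rule abs_triangle_ineq4)
      also have "\<dots> \<le> ?x / (2 * t) * exp ?x + ?x * exp ?x"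
        using True b t by (intro add_mono) (auto simp: abs_mult intro!: mult_mono divide_right_mono)
      also have "\<dots> = K * (?x * exp ?x)" by (simp add: K_def algebra_simps add_divide_distrib)
      also have "?x \<le> exp ?x"
        by (rule le_exp)
      then have "K * (?x * exp ?x) \<le> K * (exp ?x * exp ?x)"
        using K by (intro mult_left_mono mult_right_mono) auto
      finally have "\<bar>slope t v u\<bar> \<le> K * (exp ?x * exp ?x) * heat t ?x"
        using True heat_nonneg[OF t] by (auto simp: slope_def abs_mult intro!: mult_right_mono)
      then have "exp v * \<bar>slope t v u\<bar> \<le> exp ?x * (K * (exp ?x * exp ?x) * heat t ?x)"
        using True by (intro mult_mono) auto
      also have "\<dots> = K * (exp (3 * ?x) * heat t ?x)"
        by (simp add: exp_add[symmetric] mult_ac)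
      also have "\<dots> \<le> K * (C * exp (- ?x))" by (intro mult_left_mono C K)
      finally show ?thesis using True by (simp add: mult.assoc)
    next
      case False
      then show ?thesis by (auto simp: slope_def)
    qed
  qed
qed

lemma integrable_mult_slope:
  assumes t: "0 < t" and [measurable]: "h \<in> borel_measurable borel"
    and h: "\<And>v. 0 \<le> v \<Longrightarrow> \<bar>h v\<bar> \<le> exp v"
  shows "integrable (lborel \<Otimes>\<^sub>M lborel) (\<lambda>(v, u). h v * slope t v u)"
proof -
  obtain C where C: "\<And>v u. exp v * \<bar>slope t v u\<bar> \<le> (if 0 \<le> v \<and> 0 \<le> u then C * exp (- (v + u)) else 0)"
    using slope_decay[OF t] by metis
  show ?thesis
  proof (rule integrable_quadrant_bound[where f = "\<lambda>v u. h v * slope t v u" and C = C])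
    fix v u :: real
    show "\<bar>h v * slope t v u\<bar> \<le> (if 0 \<le> v \<and> 0 \<le> u then C * exp (- (v + u)) else 0)"
    proof (cases "0 \<le> v")
      case True
      then have "\<bar>h v * slope t v u\<bar> \<le> exp v * \<bar>slope t v u\<bar>"
        using h[of v] by (simp add: abs_mult mult_right_mono)
      then show ?thesis using C[of v u] by linarith
    qed (auto simp: slope_def)
  qed measurable
qed

lemma integrable_mult_decay_rate:
  assumes "0 < t" "h \<in> borel_measurable borel" "\<And>v. 0 \<le> v \<Longrightarrow> \<bar>h v\<bar> \<le> exp v"
  shows "integrable lborel (\<lambda>v. h v * decay_rate t v)"
  using lborel_pair.integrable_fst'[OF integrable_mult_slope[OF assms]] by (simp add: decay_rate_def)

lemma DERIV_heat: "0 < t \<Longrightarrow> (heat t has_real_derivative - (x / (2 * t)) * heat t x) (at x)"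
  unfolding heat_def[abs_def] divide_inverse[of _ "sqrt _"]
  by (rule derivative_eq_intros refl | simp)+

lemma integral_slope_tail:
  assumes t: "0 < t" and r: "0 \<le> r"
  shows "(LINT v|lborel. indicator {r..} v * slope t v u) = wave_kernel t r u"
proof (cases "0 \<le> u")
  case u: True
  define F where "F v = - (bessel (v * u) * heat t (v + u))" for v
  define f where "f v = ((v + u) / (2 * t) * bessel (v * u) - u * bessel' (v * u)) * heat t (v + u)" for v
  have F: "(F has_real_derivative f v) (at v)" for v
    unfolding F_def[abs_def] f_def
    by (rule derivative_eq_intros DERIV_chain2[OF DERIV_bessel] DERIV_chain2[OF DERIV_heat[OF t]] refl
        | simp add: algebra_simps)+
  have f_slope: "f v = slope t v u" if "0 \<le> v" for v
    using that u by (simp add: f_def slope_def)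
  have "isCont f v" for v
    unfolding f_def[abs_def] using t
    by (intro continuous_intros continuous_within_compose3[OF isCont_bessel'] 
      continuous_within_compose3[OF DERIV_isCont[OF DERIV_bessel]]
      continuous_within_compose3[OF DERIV_isCont[OF DERIV_heat[OF t]]]) auto
  obtain C where C: "\<And>v u. exp v * \<bar>slope t v u\<bar> \<le> (if 0 \<le> v \<and> 0 \<le> u then C * exp (- (v + u)) else 0)"
    using slope_decay[OF t] by metis
  have [measurable]: "(\<lambda>v. slope t v u) \<in> borel_measurable borel" by measurable
  have int: "set_integrable lborel {r<..} f"
  proof -
    have "integrable lborel (\<lambda>v. indicator {r<..} v * slope t v u)"
    proof (rule Bochner_Integration.integrable_bound)
      show "integrable lborel (\<lambda>v::real. \<bar>C\<bar> * (if 0 \<le> v then exp (- v) else 0))"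
        by (intro integrable_mult_right integrable_exp_minus_half_line)
      have "\<bar>indicator {r<..} v * slope t v u\<bar> \<le> \<bar>C\<bar> * (if 0 \<le> v then exp (- v) else 0)" for v
      proof (cases "0 \<le> v")
        case True
        have "\<bar>indicator {r<..} v * slope t v u\<bar> \<le> exp v * \<bar>slope t v u\<bar>"
          using True by (auto simp: abs_mult indicator_def mult_le_cancel_right1)
        also have "\<dots> \<le> C * exp (- (v + u))" using C[of v u] True u by simp
        also have "\<dots> \<le> \<bar>C\<bar> * exp (- v)" using u by (intro mult_mono) auto
        finally show ?thesis using True by simp
      qed (auto simp: slope_def)
      then show "AE v in lborel. norm (indicator {r<..} v * slope t v u) \<le> norm (\<bar>C\<bar> * (if 0 \<le> v then exp (- v) else 0))"
        by (intro AE_I2) auto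
    qed measurable
    moreover have "(\<lambda>v. indicator {r<..} v *\<^sub>R f v) = (\<lambda>v. indicator {r<..} v * slope t v u)"
      using r by (auto simp: fun_eq_iff indicator_def f_slope)
    ultimately show ?thesis by (simp only: set_integrable_def)
  qed
  obtain C' where C': "\<And>x. exp (1 * x) * heat t x \<le> C' * exp (- x)"
    using exp_heat_decay[of t 1] t by auto
  have F_top: "(F \<longlongrightarrow> 0) at_top"
  proof (rule Lim_null_comparison)
    have "\<bar>F v\<bar> \<le> C' * exp (- (v + u))" if "0 \<le> v" for v
    proof -
      have "\<bar>F v\<bar> \<le> exp (v + u) * heat t (v + u)"
        using bessel_bounds[OF that u] heat_nonneg[OF t] by (auto simp: F_def abs_mult intro!: mult_right_mono)
      then show ?thesis using C'[of "v + u"] by simp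
    qed
    then show "\<forall>\<^sub>F v in at_top. norm (F v) \<le> C' * exp (- (v + u))"
      by (auto intro: eventually_mono[OF eventually_ge_at_top[of 0]])
    show "((\<lambda>v. C' * exp (- (v + u))) \<longlongrightarrow> 0) at_top"
      by real_asymp
  qed
  have "(LBINT v=ereal r..\<infinity>. f v) = 0 - F r"
  proof (rule interval_integral_FTC_integrable)
    show "(F has_vector_derivative f v) (at v)" for v
      using F by (simp add: has_real_derivative_iff_has_vector_derivative)
    show "set_integrable lborel (einterval (ereal r) \<infinity>) f" using int by simp
    show "((F \<circ> real_of_ereal) \<longlongrightarrow> F r) (at_right (ereal r))"
      using DERIV_isCont[OF F, of r] by (simp add: ereal_tendsto_simps isCont_def filterlim_at_split)
    show "((F \<circ> real_of_ereal) \<longlongrightarrow> 0) (at_left \<infinity>)"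
      using F_top by (simp add: ereal_tendsto_simps)
  qed (use \<open>\<And>v. isCont f v\<close> in auto)
  moreover have "(LBINT v=ereal r..\<infinity>. f v) = (LINT v|lborel. indicator {r..} v * slope t v u)"
    unfolding interval_integral_to_infinity_eq set_lebesgue_integral_def
    using AE_lborel_singleton[of r] f_slope r unfolding f_def[abs_def]
    by (intro integral_cong_AE) (auto simp: indicator_def elim!: eventually_mono)
  ultimately show ?thesis using u r by (simp add: F_def wave_kernel_def)
next
  case False
  then show ?thesis by (simp add: slope_def wave_kernel_def)
qed

text \<open>Interchanging the integrals reduces the claim to the fundamental theorem of calculus for each
  fixed \<open>u\<close>, which avoids differentiating under the integral sign.\<close>
lemma profile_eq_tail:
  assumes t: "0 < t" and r: "0 \<le> r"
  shows "profile t r = (LINT v|lborel. indicator {r..} v * decay_rate t v)"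
proof -
  have "integrable (lborel \<Otimes>\<^sub>M lborel) (\<lambda>(v, u). indicator {r..} v * slope t v u)"
    by (rule integrable_mult_slope[OF t]) (auto simp: indicator_def)
  from lborel_pair.Fubini_integral[OF this]
  show ?thesis by (simp add: integral_slope_tail[OF t r] profile_def decay_rate_def)
qed

section \<open>Pointwise inversion of the sine transform\<close>

text \<open>Used with \<open>\<kappa> = 0\<close>, where the region is the triangle of \<open>0 \<le> l \<le> v\<close>, and with \<open>\<kappa> = 1\<close>, where it is
  the wedge of \<open>\<bar>l\<bar> \<le> v\<close>.\<close>
lemma integrable_wedge:
  fixes D :: "real \<Rightarrow> real"
  assumes [measurable]: "D \<in> borel_measurable borel" and vD: "integrable lborel (\<lambda>v. v * D v)" and \<kappa>: "0 \<le> \<kappa>"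
  shows "integrable (lborel \<Otimes>\<^sub>M lborel) (\<lambda>(v, l). if - (\<kappa> * v) \<le> l \<and> l \<le> v then D v else 0)"
proof (rule lborel_pair.Fubini_integrable)
  show "(\<lambda>(v, l). if - (\<kappa> * v) \<le> l \<and> l \<le> v then D v else 0) \<in> borel_measurable (lborel \<Otimes>\<^sub>M lborel)"
    by measurable
  have eq: "(if - (\<kappa> * v) \<le> l \<and> l \<le> v then D v else 0) = D v * indicator {- (\<kappa> * v)..v} l" for v l
    by (auto simp: indicator_def)
  have nonempty: "- (\<kappa> * v) \<le> v \<longleftrightarrow> 0 \<le> v" for v
  proof -
    have "0 \<le> (1 + \<kappa>) * v \<longleftrightarrow> 0 \<le> v" using \<kappa> by (simp add: zero_le_mult_iff)
    then show ?thesis unfolding distrib_right by linarith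
  qed
  have int: "integrable lborel (\<lambda>l. indicator {- (\<kappa> * v)..v} l :: real)" for v :: real
    by (cases "0 \<le> v") (auto simp: nonempty)
  show "AE v in lborel. integrable lborel (\<lambda>l. case (v, l) of (v, l) \<Rightarrow> if - (\<kappa> * v) \<le> l \<and> l \<le> v then D v else 0)"
    unfolding prod.case eq by (intro AE_I2 integrable_mult_right int)
  have "(LINT l|lborel. norm (case (v, l) of (v, l) \<Rightarrow> if - (\<kappa> * v) \<le> l \<and> l \<le> v then D v else 0))
      = (if 0 \<le> v then (1 + \<kappa>) * norm (v * D v) else 0)" for v
    unfolding prod.case eq by (cases "0 \<le> v") (auto simp: abs_mult nonempty algebra_simps)
  moreover have "integrable lborel (\<lambda>v. if 0 \<le> v then (1 + \<kappa>) * norm (v * D v) else 0)"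
  proof (rule Bochner_Integration.integrable_bound[OF integrable_mult_right[OF vD, of "1 + \<kappa>"]])
    show "AE v in lborel. norm (if 0 \<le> v then (1 + \<kappa>) * norm (v * D v) else 0) \<le> norm ((1 + \<kappa>) * (v * D v))"
      by (intro AE_I2) (auto simp: abs_mult mult_nonneg_nonpos mult_nonpos_nonneg)
  qed measurable
  ultimately show "integrable lborel (\<lambda>v. LINT l|lborel. norm (case (v, l) of (v, l) \<Rightarrow> if - (\<kappa> * v) \<le> l \<and> l \<le> v then D v else 0))"
    by simp
qed

lemma integral_sin_Icc:
  fixes \<rho> v :: real
  assumes "\<rho> \<noteq> 0" "0 \<le> v"
  shows "(LINT l|lborel. indicator {0..v} l * sin (\<rho> * l)) = (1 - cos (\<rho> * v)) / \<rho>"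
proof -
  have "(LINT l|lborel. indicator {0..v} l *\<^sub>R sin (\<rho> * l)) = (- cos (\<rho> * v) / \<rho>) - (- cos (\<rho> * 0) / \<rho>)"
  proof (rule integral_FTC_Icc)
    fix x
    show "((\<lambda>l. - cos (\<rho> * l) / \<rho>) has_vector_derivative sin (\<rho> * x)) (at x within {0..v})"
      unfolding has_real_derivative_iff_has_vector_derivative[symmetric]
      by (rule derivative_eq_intros refl | use assms in simp)+
  qed (use assms in \<open>auto intro!: continuous_intros\<close>)
  then show ?thesis by (simp add: diff_divide_distrib)
qed

text \<open>Integration by parts in the form of Fubini's theorem on the triangle of \<open>0 \<le> l \<le> v\<close>.\<close>
lemma sine_transform_by_parts:
  fixes D \<Phi> :: "real \<Rightarrow> real"
  assumes [measurable]: "D \<in> borel_measurable borel" and vD: "integrable lborel (\<lambda>v. v * D v)"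
    and D_neg: "\<And>v. v < 0 \<Longrightarrow> D v = 0"
    and \<Phi>_neg: "\<And>r. r < 0 \<Longrightarrow> \<Phi> r = 0"
    and \<Phi>: "\<And>r. 0 \<le> r \<Longrightarrow> \<Phi> r = (LINT v|lborel. indicator {r..} v * D v)"
    and \<rho>: "\<rho> \<noteq> 0"
  shows "(LINT l|lborel. sin (\<rho> * l) * \<Phi> l) = (LINT v|lborel. D v * ((1 - cos (\<rho> * v)) / \<rho>))"
proof -
  let ?f = "\<lambda>v l. sin (\<rho> * l) * (if 0 \<le> l \<and> l \<le> v then D v else 0)"
  have "integrable (lborel \<Otimes>\<^sub>M lborel) (\<lambda>(v, l). ?f v l)"
  proof (rule Bochner_Integration.integrable_bound[OF integrable_wedge[OF _ vD order_refl, simplified]])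
    have "\<bar>sin x * y\<bar> \<le> \<bar>y\<bar>" for x y :: real
      by (simp add: abs_mult mult_left_le_one_le)
    then show "AE p in lborel \<Otimes>\<^sub>M lborel. norm (case p of (v, l) \<Rightarrow> ?f v l)
        \<le> norm (case p of (v, l) \<Rightarrow> if 0 \<le> l \<and> l \<le> v then D v else 0)"
      unfolding split_beta real_norm_def by (intro AE_I2) blast
  qed measurable
  then have "(LINT l|lborel. LINT v|lborel. ?f v l) = (LINT v|lborel. LINT l|lborel. ?f v l)"
    by (rule lborel_pair.Fubini_integral)
  moreover have "(LINT v|lborel. ?f v l) = sin (\<rho> * l) * \<Phi> l" for l
  proof (cases "0 \<le> l")
    case True
    have "(LINT v|lborel. ?f v l) = (LINT v|lborel. sin (\<rho> * l) * (indicator {l..} v * D v))"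
      using True by (intro Bochner_Integration.integral_cong) (auto simp: indicator_def)
    then show ?thesis using \<Phi>[OF True] by simp
  next
    case False
    then show ?thesis using \<Phi>_neg by simp
  qed
  moreover have "(LINT l|lborel. ?f v l) = D v * ((1 - cos (\<rho> * v)) / \<rho>)" for v
  proof (cases "0 \<le> v")
    case True
    have "(LINT l|lborel. ?f v l) = (LINT l|lborel. D v * (indicator {0..v} l * sin (\<rho> * l)))"
      by (intro Bochner_Integration.integral_cong) (auto simp: indicator_def)
    then show ?thesis using integral_sin_Icc[OF \<rho> True] by simp
  next
    case False
    then have "(\<lambda>l. ?f v l) = (\<lambda>l. 0)" by auto
    then show ?thesis using D_neg False by simp
  qed
  ultimately show ?thesis by (simp only:)
qed

text \<open>The weight with which the density at \<open>v\<close> enters the sine integral truncated at \<open>R\<close>.\<close>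
definition sine_kernel :: "real \<Rightarrow> real \<Rightarrow> real \<Rightarrow> real" where
  "sine_kernel r R v = (LINT \<rho>|lborel. indicator {0..R} \<rho> * ((1 - cos (\<rho> * v)) / \<rho> * sin (r * \<rho>)))"

text \<open>The product of sine and cosine splits into three integrals of the form
  \<open>\<integral> sin (\<rho> \<theta>) / \<rho>\<close>.  Hence the weight is bounded uniformly in \<open>R\<close> and \<open>v\<close>.\<close>
lemma sine_kernel_eq_Si:
  assumes R: "0 \<le> R" and r: "0 < r"
  shows "sine_kernel r R v = Si (R * r) - (sgn (r + v) * Si (R * \<bar>r + v\<bar>) + sgn (r - v) * Si (R * \<bar>r - v\<bar>)) / 2"
proof -
  let ?s = "\<lambda>\<theta> \<rho>. sin (\<rho> * \<theta>) / \<rho>"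
  have eq: "(1 - cos (\<rho> * v)) / \<rho> * sin (r * \<rho>) = ?s r \<rho> - (?s (r + v) \<rho> + ?s (r - v) \<rho>) / 2" for \<rho>
    by (simp add: sin_add sin_diff distrib_left right_diff_distrib mult.commute[of r] diff_divide_distrib
        add_divide_distrib left_diff_distrib)
  have i: "interval_lebesgue_integrable lborel (ereal 0) (ereal R) (?s \<theta>)" for \<theta>
    by (rule integrable_sinc')
  have "sine_kernel r R v = (LBINT \<rho>=0..R. ?s r \<rho> - (?s (r + v) \<rho> + ?s (r - v) \<rho>) / 2)"
    by (simp only: sine_kernel_def interval_integral_Icc[OF R] zero_ereal_def set_lebesgue_integral_def eq real_scaleR_def)
  also have "\<dots> = (LBINT \<rho>=0..R. ?s r \<rho>) - ((LBINT \<rho>=0..R. ?s (r + v) \<rho>) + (LBINT \<rho>=0..R. ?s (r - v) \<rho>)) / 2"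
    using i unfolding zero_ereal_def
    by (simp add: interval_lebesgue_integral_diff interval_lebesgue_integral_add
      interval_lebesgue_integral_divide interval_lebesgue_integrable_divide)
  also have "\<dots> = Si (R * r) - (sgn (r + v) * Si (R * \<bar>r + v\<bar>) + sgn (r - v) * Si (R * \<bar>r - v\<bar>)) / 2"
    using LBINT_I0c_sin_scale_divide[OF R] r by simp
  finally show ?thesis .
qed

lemma borel_measurable_sine_kernel [measurable]: "sine_kernel r R \<in> borel_measurable borel"
  unfolding sine_kernel_def[abs_def] by measurable

lemma sine_kernel_limit:
  assumes r: "0 < r" and v: "0 \<le> v" "v \<noteq> r"
  shows "((\<lambda>R. sine_kernel r R v) \<longlongrightarrow> pi / 2 * indicator {r..} v) at_top"
proof -
  have lim: "((\<lambda>R. Si (R * c)) \<longlongrightarrow> pi / 2) at_top" if "0 < c" for c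
    using filterlim_compose[OF Si_at_top filterlim_tendsto_pos_mult_at_top[OF tendsto_const that filterlim_ident]]
    by (simp add: mult.commute)
  have "((\<lambda>R. Si (R * r) - (sgn (r + v) * Si (R * \<bar>r + v\<bar>) + sgn (r - v) * Si (R * \<bar>r - v\<bar>)) / 2)
    \<longlongrightarrow> pi / 2 - (sgn (r + v) * (pi / 2) + sgn (r - v) * (pi / 2)) / 2) at_top"
    using r v by (intro tendsto_intros lim) auto
  also have "pi / 2 - (sgn (r + v) * (pi / 2) + sgn (r - v) * (pi / 2)) / 2 = pi / 2 * indicator {r..} v"
    using r v by (auto simp: indicator_def sgn_if)
  finally show ?thesis
    by (rule Lim_transform_eventually)
       (auto intro!: eventually_mono[OF eventually_ge_at_top[of 0]] simp: sine_kernel_eq_Si r)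
qed

text \<open>Since \<open>\<Phi>\<close> is the tail integral of \<open>D\<close>, the truncated inversion integral is an integral of \<open>D\<close>
  against \<^const>\<open>sine_kernel\<close>.  As this weight is bounded and, away from \<open>v = r\<close>, tends to \<open>\<pi> / 2\<close> times
  the indicator of \<open>{r..}\<close>, dominated convergence gives \<open>\<pi> / 2 * \<Phi> r\<close>.  The oscillation enters only
  through the limit of the sine integral.\<close>
theorem sine_inversion:
  fixes D \<Phi> :: "real \<Rightarrow> real"
  assumes D: "integrable lborel D" and vD: "integrable lborel (\<lambda>v. v * D v)"
    and D_neg: "\<And>v. v < 0 \<Longrightarrow> D v = 0"
    and \<Phi>_neg: "\<And>r. r < 0 \<Longrightarrow> \<Phi> r = 0"
    and \<Phi>: "\<And>r. 0 \<le> r \<Longrightarrow> \<Phi> r = (LINT v|lborel. indicator {r..} v * D v)"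
    and r: "0 < r"
  shows "((\<lambda>R. LBINT \<rho>:{0..R}. (LINT l|lborel. sin (\<rho> * l) * \<Phi> l) * sin (r * \<rho>)) \<longlongrightarrow> pi / 2 * \<Phi> r) at_top"
proof -
  have Dm[measurable]: "D \<in> borel_measurable borel" using D by auto
  obtain B where B: "\<And>T. \<bar>Si T\<bar> \<le> B" using bounded_Si by blast
  have sin_le: "\<bar>sin (r * \<rho>)\<bar> \<le> r * \<bar>\<rho>\<bar>" for \<rho>
    using abs_sin_x_le_abs_x[of "r * \<rho>"] r by (simp add: abs_mult)
  have truncated: "(LBINT \<rho>:{0..R}. (LINT l|lborel. sin (\<rho> * l) * \<Phi> l) * sin (r * \<rho>)) = (LINT v|lborel. D v * sine_kernel r R v)"
    if "0 \<le> R" for R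
  proof -
    let ?k = "\<lambda>\<rho> v. indicator {0..R} \<rho> * ((1 - cos (\<rho> * v)) / \<rho> * sin (r * \<rho>))"
    \<comment> \<open>The inequality \<open>\<bar>sin x\<bar> \<le> \<bar>x\<bar>\<close> removes the singularity at \<open>\<rho> = 0\<close>.\<close>
    have k_le: "\<bar>?k \<rho> v\<bar> \<le> 2 * r * indicator {0..R} \<rho>" for \<rho> v
    proof -
      have "\<bar>1 - cos (\<rho> * v)\<bar> * \<bar>sin (r * \<rho>)\<bar> \<le> 2 * (r * \<bar>\<rho>\<bar>)"
        using sin_le[of \<rho>] abs_cos_le_one[of "\<rho> * v"] by (intro mult_mono) auto
      then show ?thesis
        using r by (cases "\<rho> = 0") (auto simp: indicator_def abs_mult divide_simps mult_ac)
    qed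
    have int: "integrable (lborel \<Otimes>\<^sub>M lborel) (\<lambda>(v, \<rho>). D v * ?k \<rho> v)"
    proof (rule Bochner_Integration.integrable_bound)
      show "integrable (lborel \<Otimes>\<^sub>M lborel) (\<lambda>(v, \<rho>). D v * (2 * r * indicator {0..R} \<rho>))"
        using that by (intro integrable_product_real D integrable_mult_right) auto
      show "AE p in lborel \<Otimes>\<^sub>M lborel. norm (case p of (v, \<rho>) \<Rightarrow> D v * ?k \<rho> v) \<le> norm (case p of (v, \<rho>) \<Rightarrow> D v * (2 * r * indicator {0..R} \<rho>))"
      proof (intro AE_I2, unfold split_paired_all prod.case real_norm_def abs_mult[of "D _"])
        fix v \<rho>
        show "\<bar>D v\<bar> * \<bar>?k \<rho> v\<bar> \<le> \<bar>D v\<bar> * \<bar>2 * r * indicator {0..R} \<rho>\<bar>"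
          by (intro mult_left_mono order_trans[OF k_le abs_ge_self] abs_ge_zero)
      qed
    qed measurable
    have "(LBINT \<rho>:{0..R}. (LINT l|lborel. sin (\<rho> * l) * \<Phi> l) * sin (r * \<rho>)) = (LINT \<rho>|lborel. LINT v|lborel. D v * ?k \<rho> v)"
      unfolding set_lebesgue_integral_def
    proof (rule Bochner_Integration.integral_cong[OF refl])
      fix \<rho>
      show "indicator {0..R} \<rho> *\<^sub>R ((LINT l|lborel. sin (\<rho> * l) * \<Phi> l) * sin (r * \<rho>)) = (LINT v|lborel. D v * ?k \<rho> v)"
      proof (cases "\<rho> = 0")
        case False
        have st: "(LINT l|lborel. sin (\<rho> * l) * \<Phi> l) = (LINT v|lborel. D v * ((1 - cos (\<rho> * v)) / \<rho>))"
          using Dm vD D_neg \<Phi>_neg \<Phi> False by (rule sine_transform_by_parts)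
        have "(LINT v|lborel. D v * ?k \<rho> v) =
            (LINT v|lborel. (D v * ((1 - cos (\<rho> * v)) / \<rho>)) * (indicator {0..R} \<rho> * sin (r * \<rho>)))"
          by (simp only: mult_ac)
        also have "\<dots> = (LINT v|lborel. D v * ((1 - cos (\<rho> * v)) / \<rho>)) * (indicator {0..R} \<rho> * sin (r * \<rho>))"
          by (rule integral_mult_left_zero)
        also have "\<dots> = indicator {0..R} \<rho> *\<^sub>R ((LINT l|lborel. sin (\<rho> * l) * \<Phi> l) * sin (r * \<rho>))"
          unfolding st real_scaleR_def by (simp only: mult_ac)
        finally show ?thesis by (rule sym)
      qed simp
    qed
    also have "\<dots> = (LINT v|lborel. LINT \<rho>|lborel. D v * ?k \<rho> v)"
      by (rule lborel_pair.Fubini_integral[OF int])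
    finally show ?thesis by (simp only: integral_mult_right_zero sine_kernel_def)
  qed
  have "((\<lambda>R. LINT v|lborel. D v * sine_kernel r R v) \<longlongrightarrow> (LINT v|lborel. D v * (pi / 2 * indicator {r..} v))) at_top"
  proof (rule integral_dominated_convergence_at_top[where w = "\<lambda>v. \<bar>D v\<bar> * (2 * B)"])
    show "integrable lborel (\<lambda>v. \<bar>D v\<bar> * (2 * B))" using D by simp
    show "AE v in lborel. ((\<lambda>R. D v * sine_kernel r R v) \<longlongrightarrow> D v * (pi / 2 * indicator {r..} v)) at_top"
      using AE_lborel_singleton[of r]
    proof eventually_elim
      fix v assume "v \<noteq> r"
      show "((\<lambda>R. D v * sine_kernel r R v) \<longlongrightarrow> D v * (pi / 2 * indicator {r..} v)) at_top"
      proof (cases "0 \<le> v")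
        case True
        then show ?thesis by (intro tendsto_mult_left sine_kernel_limit r \<open>v \<noteq> r\<close>)
      next
        case False
        then show ?thesis by (simp add: D_neg)
      qed
    qed
    show "\<forall>\<^sub>F R in at_top. AE v in lborel. norm (D v * sine_kernel r R v) \<le> \<bar>D v\<bar> * (2 * B)"
      using eventually_ge_at_top[of 0]
    proof eventually_elim
      fix R :: real assume R: "0 \<le> R"
      have s: "\<bar>sgn x * Si y\<bar> \<le> B" for x y :: real
        using B[of y] by (auto simp: sgn_if abs_mult)
      have tri: "\<bar>x - (y + z) / 2\<bar> \<le> 2 * B" if "\<bar>x\<bar> \<le> B" "\<bar>y\<bar> \<le> B" "\<bar>z\<bar> \<le> B" for x y z
        using that by (auto simp: abs_le_iff field_simps)
      have "\<bar>sine_kernel r R v\<bar> \<le> 2 * B" for v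
        unfolding sine_kernel_eq_Si[OF R r]
        by (rule tri[OF B s s])
      then show "AE v in lborel. norm (D v * sine_kernel r R v) \<le> \<bar>D v\<bar> * (2 * B)"
        by (intro AE_I2) (auto simp: abs_mult intro!: mult_left_mono)
    qed
  qed measurable
  also have "(LINT v|lborel. D v * (pi / 2 * indicator {r..} v)) = pi / 2 * \<Phi> r"
    using \<Phi>[of r] r by (simp add: mult_ac)
  finally show ?thesis
    by (rule Lim_transform_eventually)
       (auto intro!: eventually_mono[OF eventually_ge_at_top[of 0]] simp: truncated)
qed

section \<open>Gaussians as test functions\<close>

text \<open>The linear term with a complex coefficient covers both the modulated Gaussians used as test
  functions and their Fourier transforms, which are translated Gaussians.\<close>
definition gaussian_wave :: "real \<Rightarrow> complex \<Rightarrow> real \<Rightarrow> complex" where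
  "gaussian_wave c b x = exp (- of_real c * (of_real x)\<^sup>2 + b * of_real x)"

lemma norm_gaussian_wave: "norm (gaussian_wave c b x) = exp (- c * x\<^sup>2 + Re b * x)"
  by (simp add: gaussian_wave_def norm_exp_eq_Re of_real_power[symmetric] del: of_real_power)

lemma frechet_derivative_poly_gaussian_wave:
  fixes p :: "complex poly" and b :: complex and c :: real
  defines "q \<equiv> pderiv p + p * [:b, - 2 * of_real c:]"
  defines "f \<equiv> (\<lambda>x::real. poly p (of_real x) * gaussian_wave c b x)"
  shows "f differentiable (at x)"
    and "frechet_derivative f (at x) 1 = poly q (of_real x) * gaussian_wave c b x"
proof -
  have "((\<lambda>z. poly p z * exp (- of_real c * z\<^sup>2 + b * z)) has_field_derivative
      poly q (of_real x) * gaussian_wave c b x) (at (of_real x))"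
    unfolding gaussian_wave_def q_def
    by (rule derivative_eq_intros refl | simp add: algebra_simps)+
  then have "(f has_vector_derivative poly q (of_real x) * gaussian_wave c b x) (at x)"
    unfolding f_def gaussian_wave_def by (rule has_vector_derivative_real_field)
  then have D: "(f has_derivative (\<lambda>h. h *\<^sub>R (poly q (of_real x) * gaussian_wave c b x))) (at x)"
    by (simp add: has_vector_derivative_def)
  then show "f differentiable (at x)" by (rule differentiableI)
  show "frechet_derivative f (at x) 1 = poly q (of_real x) * gaussian_wave c b x"
    using frechet_derivative_at[OF D] by (metis scaleR_one)
qed

text \<open>Polynomials times a fixed Gaussian are closed under differentiation.\<close>
lemma iterated_partial_gaussian_wave:
  assumes "bs \<in> lists (Basis :: real set)"
  shows "\<exists>p. iterated_partial bs (gaussian_wave c b) = (\<lambda>x. poly p (of_real x) * gaussian_wave c b x)"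
  using assms
proof (induction bs)
  case Nil
  show ?case by (rule exI[of _ 1]) simp
next
  case (Cons d bs)
  then obtain p where p: "iterated_partial bs (gaussian_wave c b) = (\<lambda>x. poly p (of_real x) * gaussian_wave c b x)"
    by auto
  have "d = 1" using Cons.hyps by simp
  then show ?case
    unfolding iterated_partial.simps p
    by (intro exI[of _ "pderiv p + p * [:b, - 2 * of_real c:]"] ext)
      (simp only: frechet_derivative_poly_gaussian_wave(2))
qed

lemma bounded_power_gaussian_wave:
  assumes c: "0 < c"
  shows "\<exists>B. \<forall>x. \<bar>x\<bar> ^ n * norm (gaussian_wave c b x) \<le> B"
proof (intro exI allI)
  fix x :: real
  define m where "m = 1 + \<bar>Re b\<bar>"
  have "\<bar>x\<bar> ^ n / fact n \<le> exp \<bar>x\<bar>"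
    by (intro power_div_fact_le_exp) simp
  then have "\<bar>x\<bar> ^ n \<le> fact n * exp \<bar>x\<bar>" by (simp add: field_simps)
  then have "\<bar>x\<bar> ^ n * norm (gaussian_wave c b x) \<le> fact n * exp \<bar>x\<bar> * exp (- c * x\<^sup>2 + Re b * x)"
    unfolding norm_gaussian_wave by (rule mult_right_mono) simp
  also have "\<dots> = fact n * exp (\<bar>x\<bar> - c * x\<^sup>2 + Re b * x)"
    by (simp add: exp_add[symmetric])
  also have "\<bar>x\<bar> - c * x\<^sup>2 + Re b * x \<le> m\<^sup>2 / (4 * c)"
  proof -
    have "Re b * x \<le> \<bar>Re b\<bar> * \<bar>x\<bar>" by (metis abs_ge_self abs_mult)
    then have "\<bar>x\<bar> - c * x\<^sup>2 + Re b * x \<le> m * \<bar>x\<bar> - c * \<bar>x\<bar>\<^sup>2" by (simp add: m_def algebra_simps)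
    moreover have "0 \<le> (2 * c * \<bar>x\<bar> - m)\<^sup>2 / (4 * c)" using c by simp
    moreover have "(2 * c * \<bar>x\<bar> - m)\<^sup>2 / (4 * c) = m\<^sup>2 / (4 * c) - (m * \<bar>x\<bar> - c * \<bar>x\<bar>\<^sup>2)"
      using c by (simp add: power2_eq_square field_simps)
    ultimately show ?thesis by linarith
  qed
  finally show "\<bar>x\<bar> ^ n * norm (gaussian_wave c b x) \<le> fact n * exp ((1 + \<bar>Re b\<bar>)\<^sup>2 / (4 * c))"
    by (simp add: m_def)
qed

theorem schwartz_gaussian_wave:
  assumes c: "0 < c"
  shows "schwartz (gaussian_wave c b)"
  unfolding schwartz_def
proof (intro ballI conjI allI)
  fix bs :: "real list" assume bs: "bs \<in> lists Basis"
  obtain p where p: "iterated_partial bs (gaussian_wave c b) = (\<lambda>x. poly p (of_real x) * gaussian_wave c b x)"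
    using iterated_partial_gaussian_wave[OF bs] by blast
  show "iterated_partial bs (gaussian_wave c b) differentiable (at x)" for x
    unfolding p by (rule frechet_derivative_poly_gaussian_wave(1))
  fix k
  obtain B where B: "\<And>n x. \<bar>x\<bar> ^ n * norm (gaussian_wave c b x) \<le> B n"
  proof -
    have "\<forall>n. \<exists>B. \<forall>x. \<bar>x\<bar> ^ n * norm (gaussian_wave c b x) \<le> B"
      using bounded_power_gaussian_wave[OF c] by blast
    then show thesis using that unfolding choice_iff by blast
  qed
  show "bounded (range (\<lambda>x. norm x ^ k *\<^sub>R iterated_partial bs (gaussian_wave c b) x))"
    unfolding bounded_iff
  proof (intro exI ballI, elim imageE)
    fix y x assume y: "y = norm x ^ k *\<^sub>R iterated_partial bs (gaussian_wave c b) x"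
    have "norm y = \<bar>x\<bar> ^ k * norm (poly p (of_real x)) * norm (gaussian_wave c b x)"
      by (simp add: y p norm_mult power_abs)
    also have "\<dots> \<le> \<bar>x\<bar> ^ k * (\<Sum>i\<le>degree p. norm (coeff p i) * \<bar>x\<bar> ^ i) * norm (gaussian_wave c b x)"
      unfolding poly_altdef
      by (intro mult_right_mono mult_left_mono sum_norm_le) (auto simp: norm_mult norm_power)
    also have "\<dots> = (\<Sum>i\<le>degree p. norm (coeff p i) * (\<bar>x\<bar> ^ (k + i) * norm (gaussian_wave c b x)))"
      by (simp add: sum_distrib_left sum_distrib_right power_add mult_ac)
    also have "\<dots> \<le> (\<Sum>i\<le>degree p. norm (coeff p i) * B (k + i))"
      by (intro sum_mono mult_left_mono B) auto
    finally show "norm y \<le> (\<Sum>i\<le>degree p. norm (coeff p i) * B (k + i))" .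
  qed
qed

lemma fourier_gaussian_wave:
  assumes n: "0 < n"
  shows "fourier (gaussian_wave (1 / (4 * n)) (\<i> * of_real a)) x
    = of_real (sqrt (4 * pi * n) * exp (- (n * (x - a)\<^sup>2)))"
proof -
  \<comment> \<open>The substitution \<open>\<zeta> = s y\<close> turns the Gaussian into the standard normal density.\<close>
  define s where "s = sqrt (2 * n)"
  have s: "0 < s" "s\<^sup>2 = 2 * n" using n by (simp_all add: s_def)
  define \<tau> where "\<tau> = s * (a - x)"
  have "fourier (gaussian_wave (1 / (4 * n)) (\<i> * of_real a)) x
    = (LINT \<zeta>|lborel. iexp ((a - x) * \<zeta>) * of_real (exp (- \<zeta>\<^sup>2 / (4 * n))))"
    unfolding fourier_def gaussian_wave_def
    by (intro Bochner_Integration.integral_cong refl)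
       (simp add: exp_of_real[symmetric] exp_add[symmetric] algebra_simps)
  also have "\<dots> = \<bar>s\<bar> *\<^sub>R (LINT y|lborel. iexp ((a - x) * (0 + s * y)) * of_real (exp (- (0 + s * y)\<^sup>2 / (4 * n))))"
    using s by (intro lborel_integral_real_affine) auto
  also have "\<dots> = \<bar>s\<bar> *\<^sub>R (LINT y|lborel. of_real (sqrt (2 * pi)) * (std_normal_density y *\<^sub>R iexp (\<tau> * y)))"
    using n s by (intro arg_cong[where f = "\<lambda>z. \<bar>s\<bar> *\<^sub>R z"] Bochner_Integration.integral_cong refl)
       (simp add: std_normal_density_def \<tau>_def power_mult_distrib scaleR_conv_of_real mult_ac)
  also have "\<dots> = of_real (s * sqrt (2 * pi)) * (LINT y|lborel. std_normal_density y *\<^sub>R iexp (\<tau> * y))"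
    using s by (simp add: scaleR_conv_of_real)
  also have "(LINT y|lborel. std_normal_density y *\<^sub>R iexp (\<tau> * y)) = char std_normal_distribution \<tau>"
    unfolding char_def by (subst integral_density) auto
  also have "\<dots> = of_real (exp (- \<tau>\<^sup>2 / 2))"
    by (simp add: char_std_normal_distribution)
  also have "- \<tau>\<^sup>2 / 2 = - (n * (x - a)\<^sup>2)"
    using s(2) by (simp add: \<tau>_def power_mult_distrib power2_commute)
  also have "s * sqrt (2 * pi) = sqrt (4 * pi * n)"
    by (simp add: s_def real_sqrt_mult[symmetric])
  finally show ?thesis by (simp only: of_real_mult)
qed

lemma shifted_gaussian_eq_gaussian_wave:
  "complex_of_real (exp (- (n * (x - a)\<^sup>2))) = of_real (exp (- n * a\<^sup>2)) * gaussian_wave n (of_real (2 * n * a)) x"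
  by (simp add: gaussian_wave_def exp_of_real[symmetric] exp_add[symmetric] power2_diff algebra_simps)

text \<open>If \<open>F a > 0\<close>, then \<open>F \<ge> \<eta> > 0\<close> for \<open>\<bar>x - a\<bar> < \<delta>\<close>.  Multiply the means by
  \<open>exp (n * \<delta>\<^sup>2)\<close>: the weight becomes at least one inside this interval, so the inner part of the
  integral is at least \<open>2 \<delta> \<eta>\<close>, whereas outside it decreases to zero and the outer part vanishes in the
  limit.  Their sum cannot be zero for all \<open>n\<close>.\<close>
lemma continuous_nonpos_if_gaussian_means_zero:
  fixes F :: "real \<Rightarrow> real"
  assumes cont: "isCont F a"
    and int: "\<And>n::nat. 1 \<le> n \<Longrightarrow> integrable lborel (\<lambda>x. F x * exp (- (real n * (x - a)\<^sup>2)))"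
    and zero: "\<And>n::nat. 1 \<le> n \<Longrightarrow> (LINT x|lborel. F x * exp (- (real n * (x - a)\<^sup>2))) = 0"
  shows "F a \<le> 0"
proof (rule ccontr)
  assume "\<not> F a \<le> 0"
  define \<eta> where "\<eta> = F a / 2"
  have \<eta>: "0 < \<eta>" using \<open>\<not> F a \<le> 0\<close> by (simp add: \<eta>_def)
  obtain \<delta> where \<delta>: "0 < \<delta>" "\<And>x. \<bar>x - a\<bar> < \<delta> \<Longrightarrow> \<eta> \<le> F x"
  proof -
    obtain \<delta> where "0 < \<delta>" "\<And>x. \<bar>x - a\<bar> < \<delta> \<Longrightarrow> \<bar>F x - F a\<bar> < \<eta>"
      using cont \<eta> unfolding continuous_at_eps_delta dist_real_def by metis
    moreover have "\<eta> \<le> y" if "\<bar>y - F a\<bar> < \<eta>" for y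
      using that unfolding \<eta>_def by linarith
    ultimately show thesis using that by blast
  qed
  define w where "w n x = F x * exp (n * (\<delta>\<^sup>2 - (x - a)\<^sup>2))" for n x
  let ?I = "{a - \<delta><..<a + \<delta>}"
  have w_eq: "w n x = exp (n * \<delta>\<^sup>2) * (F x * exp (- (n * (x - a)\<^sup>2)))" for n x
    by (simp add: w_def exp_add[symmetric] algebra_simps)
  have w_int: "integrable lborel (w (real n))" and w_zero: "(LINT x|lborel. w (real n) x) = 0" if "1 \<le> n" for n :: nat
    unfolding w_eq[abs_def] using int[OF that] zero[OF that] by auto
  have int_in: "integrable lborel (\<lambda>x. indicator ?I x * w (real n) x)"
    and int_out: "integrable lborel (\<lambda>x. (1 - indicator ?I x) * w (real n) x)" if "1 \<le> n" for n :: nat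
    using w_int[OF that] by (auto intro!: Bochner_Integration.integrable_bound[OF w_int[OF that]] simp: indicator_def)
  have lower: "2 * \<delta> * \<eta> \<le> - (LINT x|lborel. (1 - indicator ?I x) * w (real n) x)" if n: "1 \<le> n" for n :: nat
  proof -
    have "2 * \<delta> * \<eta> = (LINT x|lborel. indicator ?I x * \<eta>)" using \<delta> by simp
    also have "\<dots> \<le> (LINT x|lborel. indicator ?I x * w n x)"
    proof (rule integral_mono[OF _ int_in[OF n]])
      show "integrable lborel (\<lambda>x. indicator ?I x * \<eta>)" using \<delta>(1) by simp
      fix x
      show "indicator ?I x * \<eta> \<le> indicator ?I x * w n x"
      proof (cases "x \<in> ?I")
        case True
        then have x: "\<bar>x - a\<bar> < \<delta>" by auto
        then have "(x - a)\<^sup>2 \<le> \<delta>\<^sup>2" by (metis abs_ge_zero less_imp_le power2_abs power_mono)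
        then have "1 \<le> exp (n * (\<delta>\<^sup>2 - (x - a)\<^sup>2))" by simp
        then have "\<eta> * 1 \<le> w n x" unfolding w_def using \<delta>(2)[OF x] \<eta> by (intro mult_mono) auto
        then show ?thesis using True by simp
      qed simp
    qed
    also have "\<dots> = - (LINT x|lborel. (1 - indicator ?I x) * w n x)"
      using w_zero[OF n] int_in[OF n] int_out[OF n] w_int[OF n] by (simp add: left_diff_distrib)
    finally show ?thesis .
  qed
  have "(\<lambda>n::nat. LINT x|lborel. (1 - indicator ?I x) * w (Suc n) x) \<longlonglongrightarrow> (LINT x|(lborel::real measure). 0)"
  proof (rule integral_dominated_convergence[where w = "\<lambda>x. \<bar>w 1 x\<bar>"])
    show "integrable lborel (\<lambda>x. \<bar>w 1 x\<bar>)" using w_int[of 1] by simp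
    show "(\<lambda>x. (1 - indicator ?I x) * w (Suc n) x) \<in> borel_measurable lborel" for n
      using int_out[of "Suc n"] by (simp del: of_nat_Suc)
    show "AE x in lborel. (\<lambda>n. (1 - indicator ?I x) * w (Suc n) x) \<longlonglongrightarrow> 0"
      using AE_lborel_singleton[of "a - \<delta>"] AE_lborel_singleton[of "a + \<delta>"]
    proof eventually_elim
      fix x assume x: "x \<noteq> a - \<delta>" "x \<noteq> a + \<delta>"
      show "(\<lambda>n. (1 - indicator ?I x) * w (Suc n) x) \<longlonglongrightarrow> 0"
      proof (cases "x \<in> ?I")
        case False
        then have "\<delta> < \<bar>x - a\<bar>" using x by auto
        then have "\<delta>\<^sup>2 < \<bar>x - a\<bar>\<^sup>2" using \<delta>(1) by (intro power_strict_mono) auto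
        then have "0 < (x - a)\<^sup>2 - \<delta>\<^sup>2" by simp
        then have "(\<lambda>n. F x * exp (real (Suc n) * (- ((x - a)\<^sup>2 - \<delta>\<^sup>2)))) \<longlonglongrightarrow> F x * 0"
          by (intro tendsto_mult_left) real_asymp
        then show ?thesis using False by (simp add: w_def)
      qed simp
    qed
    show "AE x in lborel. norm ((1 - indicator ?I x) * w (Suc n) x) \<le> \<bar>w 1 x\<bar>" for n
    proof (rule AE_I2)
      fix x
      show "norm ((1 - indicator ?I x) * w (Suc n) x) \<le> \<bar>w 1 x\<bar>"
      proof (cases "x \<in> ?I")
        case False
        then have "\<delta> \<le> \<bar>x - a\<bar>" by auto
        then have "\<delta>\<^sup>2 \<le> \<bar>x - a\<bar>\<^sup>2" using \<delta>(1) by (intro power_mono) auto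
        then have "real (Suc n) * (\<delta>\<^sup>2 - (x - a)\<^sup>2) \<le> 1 * (\<delta>\<^sup>2 - (x - a)\<^sup>2)"
          by (intro mult_right_mono_neg) auto
        then have "exp (real (Suc n) * (\<delta>\<^sup>2 - (x - a)\<^sup>2)) \<le> exp (1 * (\<delta>\<^sup>2 - (x - a)\<^sup>2))" by simp
        then show ?thesis using False by (auto simp: w_def abs_mult simp del: of_nat_Suc intro!: mult_left_mono)
      qed simp
    qed
  qed simp_all
  then have "(\<lambda>n::nat. - (LINT x|lborel. (1 - indicator ?I x) * w (Suc n) x)) \<longlonglongrightarrow> - 0"
    by (intro tendsto_minus) simp
  moreover have "2 * \<delta> * \<eta> \<le> - (LINT x|lborel. (1 - indicator ?I x) * w (Suc n) x)" for n
    using lower[of "Suc n"] by simp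
  ultimately have "2 * \<delta> * \<eta> \<le> - 0"
    by (intro LIMSEQ_le_const[of "\<lambda>n. - (LINT x|lborel. (1 - indicator ?I x) * w (Suc n) x)"]) blast+
  then show False using mult_pos_pos[OF \<delta>(1) \<eta>] by simp
qed

section \<open>A continuous fundamental function is determined by its Fourier transform\<close>

text \<open>The multiplication formula for the Fourier transform.\<close>
lemma regular_distribution_fourier:
  fixes g :: "real \<Rightarrow> real" and \<phi> :: "real \<Rightarrow> complex"
  assumes g: "integrable lborel g" and \<phi>: "integrable lborel \<phi>"
  shows "(LINT \<zeta>|lborel. fourier (\<lambda>x. of_real (g x)) \<zeta> * \<phi> \<zeta>) = regular_distribution g (fourier \<phi>)"
proof -
  let ?f = "\<lambda>\<zeta> x. exp (- (\<i> * of_real (x \<bullet> \<zeta>))) * of_real (g x) * \<phi> \<zeta>"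
  have [measurable]: "g \<in> borel_measurable borel" "\<phi> \<in> borel_measurable borel" using g \<phi> by auto
  have "integrable (lborel \<Otimes>\<^sub>M lborel) (\<lambda>(\<zeta>, x). ?f \<zeta> x)"
  proof (rule Bochner_Integration.integrable_bound)
    show "integrable (lborel \<Otimes>\<^sub>M lborel) (\<lambda>(\<zeta>, x). norm (\<phi> \<zeta>) * g x)"
      by (intro integrable_product_real integrable_norm g \<phi>)
    show "AE p in lborel \<Otimes>\<^sub>M lborel. norm (case p of (\<zeta>, x) \<Rightarrow> ?f \<zeta> x) \<le> norm (case p of (\<zeta>, x) \<Rightarrow> norm (\<phi> \<zeta>) * g x)"
      by (intro AE_I2) (auto simp: norm_mult norm_exp_eq_Re abs_mult mult.commute)
  qed measurable
  then have "(LINT x|lborel. LINT \<zeta>|lborel. ?f \<zeta> x) = (LINT \<zeta>|lborel. LINT x|lborel. ?f \<zeta> x)"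
    by (rule lborel_pair.Fubini_integral)
  moreover have "(LINT \<zeta>|lborel. ?f \<zeta> x) = of_real (g x) * fourier \<phi> x" for x
  proof -
    have "(LINT \<zeta>|lborel. ?f \<zeta> x) = (LINT \<zeta>|lborel. of_real (g x) * (exp (- (\<i> * of_real (\<zeta> \<bullet> x))) * \<phi> \<zeta>))"
      by (simp only: inner_commute[of x] mult_ac)
    then show ?thesis unfolding fourier_def by (simp only: integral_mult_right_zero)
  qed
  moreover have "(LINT x|lborel. ?f \<zeta> x) = fourier (\<lambda>x. of_real (g x)) \<zeta> * \<phi> \<zeta>" for \<zeta>
    unfolding fourier_def by (rule integral_mult_left_zero)
  ultimately show ?thesis by (simp only: regular_distribution_def)
qed

lemma integrable_gaussian_wave:
  assumes c: "0 < c"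
  shows "integrable lborel (gaussian_wave c (\<i> * of_real a))"
proof -
  have [measurable]: "gaussian_wave c b \<in> borel_measurable borel" for b
    unfolding gaussian_wave_def[abs_def] by measurable
  define \<sigma> where "\<sigma> = sqrt (1 / (2 * c))"
  have \<sigma>: "2 * \<sigma>\<^sup>2 = 1 / c" using c by (simp add: \<sigma>_def)
  have "integrable lborel (\<lambda>x. sqrt (2 * pi * \<sigma>\<^sup>2) * normal_density 0 \<sigma> x)"
    by (intro integrable_mult_right integrable_normal_density) (use c in \<open>simp add: \<sigma>_def\<close>)
  moreover have "norm (gaussian_wave c (\<i> * of_real a) x) = sqrt (2 * pi * \<sigma>\<^sup>2) * normal_density 0 \<sigma> x" for x
    using c \<sigma> by (simp add: norm_gaussian_wave normal_density_def \<sigma>_def)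
  ultimately have "integrable lborel (\<lambda>x. norm (gaussian_wave c (\<i> * of_real a) x))"
    by (simp only:)
  then show ?thesis by (rule integrable_norm_cancel) measurable
qed

text \<open>Testing with the wave \<open>gaussian_wave (1 / (4 n)) (\<i> a)\<close> shows that \<open>f\<close> and \<open>g\<close> have the same
  Gaussian means around \<open>a\<close> at every scale.  The frequency \<open>\<zeta> = 0\<close> may be excluded as a null set.\<close>
theorem velocity_fundamental_function_unique:
  fixes f g :: "real \<Rightarrow> real"
  assumes f: "velocity_fundamental_function t f" and f_cont: "isCont f a"
    and g: "integrable lborel g" and g_cont: "isCont g a"
    and g_fourier: "\<And>\<zeta>. \<zeta> \<noteq> 0 \<Longrightarrow> fourier (\<lambda>x. of_real (g x)) \<zeta> = of_real (S1_hat t \<bar>\<zeta>\<bar>)"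
  shows "f a = g a"
proof -
  let ?e = "\<lambda>n x. exp (- (real n * (x - a)\<^sup>2))"
  have f_int: "integrable lborel (\<lambda>x. f x * ?e n x)" if n: "1 \<le> n" for n :: nat
  proof -
    have "schwartz (gaussian_wave (real n) (of_real (2 * real n * a)))"
      using n by (intro schwartz_gaussian_wave) simp
    then have "integrable lborel (\<lambda>x. of_real (f x) * gaussian_wave (real n) (of_real (2 * real n * a)) x)"
      using f unfolding velocity_fundamental_function_def by blast
    then have "integrable lborel (\<lambda>x. of_real (exp (- real n * a\<^sup>2)) * (of_real (f x) * gaussian_wave (real n) (of_real (2 * real n * a)) x))"
      by (rule integrable_mult_right)
    moreover have "of_real (exp (- real n * a\<^sup>2)) * (of_real (f x) * gaussian_wave (real n) (of_real (2 * real n * a)) x)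
        = complex_of_real (f x * ?e n x)" for x
      unfolding of_real_mult shifted_gaussian_eq_gaussian_wave by (simp only: mult_ac)
    ultimately show ?thesis by (simp only: complex_of_real_integrable_eq)
  qed
  have g_int: "integrable lborel (\<lambda>x. g x * ?e n x)" for n :: nat
    by (rule Bochner_Integration.integrable_bound[OF g]) (use g in \<open>auto simp: abs_mult mult_left_le\<close>)
  have same: "(LINT x|lborel. f x * ?e n x) = (LINT x|lborel. g x * ?e n x)" if n: "1 \<le> n" for n :: nat
  proof -
    define \<phi> where "\<phi> = gaussian_wave (1 / (4 * real n)) (\<i> * of_real a)"
    define K where "K = sqrt (4 * pi * real n)"
    have \<phi>: "schwartz \<phi>" "integrable lborel \<phi>"
      unfolding \<phi>_def using n by (auto intro!: schwartz_gaussian_wave integrable_gaussian_wave)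
    have fourier_\<phi>: "fourier \<phi> x = of_real (K * ?e n x)" for x
      unfolding \<phi>_def K_def using n by (intro fourier_gaussian_wave) simp
    have reg: "regular_distribution h (fourier \<phi>) = of_real (K * (LINT x|lborel. h x * ?e n x))" for h :: "real \<Rightarrow> real"
    proof -
      have "regular_distribution h (fourier \<phi>) = (LINT x|lborel. complex_of_real (K * (h x * ?e n x)))"
        unfolding regular_distribution_def fourier_\<phi> by (simp only: of_real_mult mult_ac)
      then show ?thesis by (simp only: integral_complex_of_real integral_mult_right_zero)
    qed
    have "regular_distribution f (fourier \<phi>) = regular_distribution (\<lambda>\<zeta>. S1_hat t (norm \<zeta>)) \<phi>"
      using f \<phi>(1)
      by (auto simp: velocity_fundamental_function_def velocity_fundamental_solution_def fourier_distribution_def)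
    also have "\<dots> = (LINT \<zeta>|lborel. fourier (\<lambda>x. of_real (g x)) \<zeta> * \<phi> \<zeta>)"
      unfolding regular_distribution_def
    proof (rule integral_discrete_difference[where X = "{0}"])
    qed (auto simp: g_fourier)
    also have "\<dots> = regular_distribution g (fourier \<phi>)"
      by (rule regular_distribution_fourier[OF g \<phi>(2)])
    finally show ?thesis using n by (simp add: reg K_def)
  qed
  have "f a - g a \<le> 0"
    using f_int g_int same
    by (intro continuous_nonpos_if_gaussian_means_zero[where F = "\<lambda>x. f x - g x"] continuous_diff f_cont g_cont)
      (simp_all add: left_diff_distrib)
  moreover have "g a - f a \<le> 0"
    using f_int g_int same
    by (intro continuous_nonpos_if_gaussian_means_zero[where F = "\<lambda>x. g x - f x"] continuous_diff f_cont g_cont)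
      (simp_all add: left_diff_distrib)
  ultimately show ?thesis by simp
qed

section \<open>The one-dimensional fundamental function\<close>

lemma integrable_profile: "0 < t \<Longrightarrow> integrable lborel (profile t)"
  and integrable_mult_profile: "0 < t \<Longrightarrow> integrable lborel (\<lambda>r. r * profile t r)"
proof -
  assume t: "0 < t"
  show "integrable lborel (profile t)"
    using integral_mult_kernel(1)[OF t order_refl, of "\<lambda>_. 1"] by simp
  have "\<bar>r\<bar> \<le> exp (1 * r)" if "0 \<le> r" for r :: real
    using that le_exp[of r] by simp
  then show "integrable lborel (\<lambda>r. r * profile t r)"
    by (intro integral_mult_kernel(1)[OF t, of 1]) auto
qed

text \<open>The candidate for \<open>G1 t\<close>.\<close>
definition wave_function :: "real \<Rightarrow> real \<Rightarrow> real" where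
  "wave_function t x = exp (- t) / 2 * (LINT v|lborel. indicator {\<bar>x\<bar>..} v * profile t v)"

lemma integrable_indicator_profile:
  assumes "0 < t" "A \<in> sets borel"
  shows "integrable lborel (\<lambda>v. indicator A v * profile t v)"
  by (rule Bochner_Integration.integrable_bound[OF integrable_profile[OF assms(1)]])
    (use assms in \<open>auto simp: indicator_def\<close>)

lemma wave_function_nonneg: "0 < t \<Longrightarrow> 0 \<le> wave_function t x"
  by (auto simp: wave_function_def profile_nonneg intro!: mult_nonneg_nonneg Bochner_Integration.integral_nonneg)

lemma wave_function_antimono:
  assumes "0 < t" "\<bar>x\<bar> \<le> \<bar>y\<bar>"
  shows "wave_function t y \<le> wave_function t x"
  unfolding wave_function_def
  by (intro mult_left_mono integral_mono integrable_indicator_profile)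
    (use assms in \<open>auto simp: indicator_def profile_nonneg\<close>)

text \<open>Only the boundary point \<open>v = \<bar>x\<bar>\<close> of the tail can fail to converge, and it is a null set.\<close>
lemma isCont_wave_function:
  assumes t: "0 < t"
  shows "isCont (wave_function t) x"
proof (rule continuous_at_sequentiallyI)
  fix X :: "nat \<Rightarrow> real" assume X: "X \<longlonglongrightarrow> x"
  have "(\<lambda>n. LINT v|lborel. indicator {\<bar>X n\<bar>..} v * profile t v) \<longlonglongrightarrow> (LINT v|lborel. indicator {\<bar>x\<bar>..} v * profile t v)"
  proof (rule integral_dominated_convergence[where w = "profile t"])
    show "integrable lborel (profile t)" by (rule integrable_profile[OF t])
    show "AE v in lborel. (\<lambda>n. indicator {\<bar>X n\<bar>..} v * profile t v) \<longlonglongrightarrow> indicator {\<bar>x\<bar>..} v * profile t v"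
      using AE_lborel_singleton[of "\<bar>x\<bar>"]
    proof eventually_elim
      fix v assume v: "v \<noteq> \<bar>x\<bar>"
      have abs: "(\<lambda>n. \<bar>X n\<bar>) \<longlonglongrightarrow> \<bar>x\<bar>" by (intro tendsto_rabs X)
      have "\<forall>\<^sub>F n in sequentially. (indicator {\<bar>x\<bar>..} v * profile t v) = indicator {\<bar>X n\<bar>..} v * profile t v"
      proof (cases "\<bar>x\<bar> < v")
        case True
        show ?thesis by (rule eventually_mono[OF order_tendstoD(2)[OF abs True]]) (use True in \<open>auto simp: indicator_def\<close>)
      next
        case False
        with v have "v < \<bar>x\<bar>" by simp
        show ?thesis by (rule eventually_mono[OF order_tendstoD(1)[OF abs \<open>v < \<bar>x\<bar>\<close>]]) (use \<open>v < \<bar>x\<bar>\<close> in \<open>auto simp: indicator_def\<close>)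
      qed
      then show "(\<lambda>n. indicator {\<bar>X n\<bar>..} v * profile t v) \<longlonglongrightarrow> indicator {\<bar>x\<bar>..} v * profile t v"
        by (rule Lim_transform_eventually[OF tendsto_const])
    qed
    show "AE v in lborel. norm (indicator {\<bar>X n\<bar>..} v * profile t v) \<le> profile t v" for n
      by (intro AE_I2) (auto simp: indicator_def profile_nonneg t)
  qed measurable
  then show "(\<lambda>n. wave_function t (X n)) \<longlonglongrightarrow> wave_function t x"
    unfolding wave_function_def by (rule tendsto_mult_left)
qed

lemma integral_cis_symmetric:
  fixes \<zeta> v :: real
  assumes \<zeta>: "\<zeta> \<noteq> 0" and v: "0 \<le> v"
  shows "(LINT x|lborel. indicator {- v..v} x *\<^sub>R exp (- (\<i> * of_real (x * \<zeta>)))) = of_real (2 * (sin (\<zeta> * v) / \<zeta>))"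
proof -
  let ?F = "\<lambda>x. \<i> / of_real \<zeta> * exp (- (\<i> * of_real (x * \<zeta>)))"
  have "(LINT x|lborel. indicator {- v..v} x *\<^sub>R exp (- (\<i> * of_real (x * \<zeta>)))) = ?F v - ?F (- v)"
  proof (rule integral_FTC_Icc)
    fix x
    have "((\<lambda>z. \<i> / of_real \<zeta> * exp (- (\<i> * (z * of_real \<zeta>)))) has_field_derivative exp (- (\<i> * (of_real x * of_real \<zeta>)))) (at (of_real x))"
      using \<zeta> by (auto intro!: derivative_eq_intros)
    then show "(?F has_vector_derivative exp (- (\<i> * of_real (x * \<zeta>)))) (at x within {- v..v})"
      unfolding of_real_mult by (rule has_vector_derivative_real_field)
  qed (use v in \<open>auto intro!: continuous_intros\<close>)
  also have "\<dots> = of_real (2 * (sin (\<zeta> * v) / \<zeta>))"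
  proof -
    have E: "exp (- (\<i> * of_real y)) = cis (- y)" for y :: real by (simp add: cis_conv_exp)
    show ?thesis unfolding E using \<zeta> by (simp add: complex_eq_iff mult.commute)
  qed
  finally show ?thesis .
qed

text \<open>Written as an integral over \<open>\<bar>x\<bar> \<le> v\<close>, the Fourier transform meets \<open>exp (- \<i> x \<zeta>)\<close> on a
  symmetric interval, which gives \<open>2 sin (\<zeta> v) / \<zeta>\<close> and hence the sine transform of the profile.\<close>
lemma wave_function_transform:
  assumes t: "0 < t"
  shows integrable_wave_function: "integrable lborel (wave_function t)"
    and fourier_wave_function: "\<zeta> \<noteq> 0 \<Longrightarrow> fourier (\<lambda>x. of_real (wave_function t x)) \<zeta> = of_real (S1_hat t \<bar>\<zeta>\<bar>)"
proof -
  let ?P = "\<lambda>v x. if - (1 * v) \<le> x \<and> x \<le> v then profile t v else 0"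
  have int: "integrable (lborel \<Otimes>\<^sub>M lborel) (\<lambda>(v, x). ?P v x)"
    by (rule integrable_wedge[OF _ integrable_mult_profile[OF t]]) auto
  have inner: "(LINT v|lborel. ?P v x) = (LINT v|lborel. indicator {\<bar>x\<bar>..} v * profile t v)" for x
    by (intro Bochner_Integration.integral_cong) (auto simp: indicator_def abs_le_iff)
  have "integrable lborel (\<lambda>x. LINT v|lborel. ?P v x)"
    using lborel_pair.integrable_fst'[OF lborel_pair.integrable_product_swap[OF int]] by simp
  then show "integrable lborel (wave_function t)"
    unfolding inner wave_function_def[abs_def] by (rule integrable_mult_right)
  assume \<zeta>: "\<zeta> \<noteq> 0"
  let ?E = "\<lambda>x. exp (- (\<i> * of_real (x * \<zeta>))) :: complex"
  have "integrable (lborel \<Otimes>\<^sub>M lborel) (\<lambda>(v, x). ?E x * of_real (?P v x))"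
  proof (rule Bochner_Integration.integrable_bound[OF int])
    show "AE p in lborel \<Otimes>\<^sub>M lborel. norm (case p of (v, x) \<Rightarrow> ?E x * of_real (?P v x)) \<le> norm (case p of (v, x) \<Rightarrow> ?P v x)"
      by (intro AE_I2) (auto simp: norm_mult norm_exp_eq_Re)
  qed measurable
  then have "(LINT x|lborel. LINT v|lborel. ?E x * of_real (?P v x)) = (LINT v|lborel. LINT x|lborel. ?E x * of_real (?P v x))"
    by (rule lborel_pair.Fubini_integral)
  also have "\<dots> = (LINT v|lborel. complex_of_real (2 / \<zeta> * (sin (\<zeta> * v) * profile t v)))"
  proof (rule Bochner_Integration.integral_cong[OF refl])
    fix v
    show "(LINT x|lborel. ?E x * of_real (?P v x)) = complex_of_real (2 / \<zeta> * (sin (\<zeta> * v) * profile t v))"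
    proof (cases "0 \<le> v")
      case True
      have "(LINT x|lborel. ?E x * of_real (?P v x)) = (LINT x|lborel. (indicator {- v..v} x *\<^sub>R ?E x) * of_real (profile t v))"
        by (intro Bochner_Integration.integral_cong) (auto simp: indicator_def)
      also have "\<dots> = of_real (2 * (sin (\<zeta> * v) / \<zeta>)) * of_real (profile t v)"
        unfolding integral_mult_left_zero integral_cis_symmetric[OF \<zeta> True] ..
      finally show ?thesis by simp
    next
      case False
      then show ?thesis using profile_negative[of v t] by (simp cong: if_cong)
    qed
  qed
  also have "\<dots> = of_real (2 / \<zeta> * (LINT v|lborel. sin (\<zeta> * v) * profile t v))"
    by (simp only: integral_complex_of_real integral_mult_right_zero)
  also have "(LINT v|lborel. sin (\<zeta> * v) * profile t v) = \<zeta> * freq_series \<bar>\<zeta>\<bar> 0 t"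
  proof -
    have "(LINT v|lborel. sin (\<bar>\<zeta>\<bar> * v) * profile t v) = sgn \<zeta> * (LINT v|lborel. sin (\<zeta> * v) * profile t v)"
      by (simp add: sgn_if abs_if)
    then have "sgn \<zeta> * (LINT v|lborel. sin (\<zeta> * v) * profile t v) = \<bar>\<zeta>\<bar> * freq_series \<bar>\<zeta>\<bar> 0 t"
      using freq_series_eq_sine_transform[OF t, of "\<bar>\<zeta>\<bar>"] by simp
    then show ?thesis using \<zeta> by (simp add: sgn_if abs_if split: if_splits)
  qed
  finally have *: "(LINT x|lborel. LINT v|lborel. ?E x * of_real (?P v x)) = of_real (2 * freq_series \<bar>\<zeta>\<bar> 0 t)"
    using \<zeta> by simp
  have factor: "(LINT v|lborel. ?E x * of_real (?P v x)) = ?E x * of_real (LINT v|lborel. ?P v x)" for x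
    by (simp only: integral_mult_right_zero integral_complex_of_real)
  have "fourier (\<lambda>x. of_real (wave_function t x)) \<zeta> = (LINT x|lborel. of_real (exp (- t) / 2) * (LINT v|lborel. ?E x * of_real (?P v x)))"
    unfolding fourier_def wave_function_def inner[symmetric] factor
    by (simp only: inner_real_def of_real_mult mult_ac)
  also have "\<dots> = of_real (exp (- t) / 2) * (LINT x|lborel. LINT v|lborel. ?E x * of_real (?P v x))"
    by (rule integral_mult_right_zero)
  also have "\<dots> = of_real (S1_hat t \<bar>\<zeta>\<bar>)"
    unfolding * by (simp add: S1_hat_eq_series)
  finally show "fourier (\<lambda>x. of_real (wave_function t x)) \<zeta> = of_real (S1_hat t \<bar>\<zeta>\<bar>)" .
qed

section \<open>The three-dimensional fundamental function and the relation\<close>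

lemma sine_integral_S1_hat:
  assumes t: "0 < t" and r: "0 < r"
  shows "((\<lambda>R. LBINT \<rho>:{0..R}. S1_hat t \<rho> * \<rho> * sin (r * \<rho>)) \<longlongrightarrow> exp (- t) * (pi / 2 * profile t r)) at_top"
proof -
  have D: "integrable lborel (decay_rate t)"
    using integrable_mult_decay_rate[OF t, of "\<lambda>_. 1"] by simp
  have "\<bar>v\<bar> \<le> exp v" if "0 \<le> v" for v :: real
    using that le_exp[of v] by simp
  then have vD: "integrable lborel (\<lambda>v. v * decay_rate t v)"
    by (intro integrable_mult_decay_rate[OF t]) auto
  have neg: "decay_rate t v = 0" if "v < 0" for v
    using that by (simp add: decay_rate_def slope_def)
  have "((\<lambda>R. LBINT \<rho>:{0..R}. (LINT l|lborel. sin (\<rho> * l) * profile t l) * sin (r * \<rho>)) \<longlongrightarrow> pi / 2 * profile t r) at_top"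
    using D vD neg profile_negative profile_eq_tail[OF t] r by (rule sine_inversion)
  then have "((\<lambda>R. exp (- t) * (LBINT \<rho>:{0..R}. (LINT l|lborel. sin (\<rho> * l) * profile t l) * sin (r * \<rho>)))
      \<longlongrightarrow> exp (- t) * (pi / 2 * profile t r)) at_top"
    by (rule tendsto_mult_left)
  moreover have "exp (- t) * (LBINT \<rho>:{0..R}. (LINT l|lborel. sin (\<rho> * l) * profile t l) * sin (r * \<rho>))
      = (LBINT \<rho>:{0..R}. S1_hat t \<rho> * \<rho> * sin (r * \<rho>))" for R
    unfolding set_integral_mult_right[symmetric] freq_series_eq_sine_transform[OF t, symmetric] S1_hat_eq_series
    by (simp only: mult_ac)
  ultimately show ?thesis by (simp only:)
qed

theorem proposition4p3:
  fixes G1 G3 :: "real \<Rightarrow> real \<Rightarrow> real"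
  assumes G1_fundamental: "\<And>t. t > 0 \<Longrightarrow> velocity_fundamental_function t (G1 t)"
    and G1_continuous: "\<And>t. t > 0 \<Longrightarrow> continuous_on UNIV (G1 t)"
    and G3_fundamental:
      "\<And>t. t > 0 \<Longrightarrow> velocity_fundamental_function t (\<lambda>x :: real ^ 3. G3 t (norm x))"
    and G3_pointwise:
      "\<And>t r. t > 0 \<Longrightarrow> r > 0 \<Longrightarrow>
         G3 t r = 1 / (2 * pi\<^sup>2 * r) *
           Lim at_top (\<lambda>R. LBINT \<rho>:{0..R}. S1_hat t \<rho> * \<rho> * sin (r * \<rho>))"
  shows "(\<forall>t>0. \<forall>r\<ge>0. set_integrable lborel {r..} (\<lambda>l. G3 t l * l) \<and>
            G1 t r = 2 * pi * (LBINT l:{r..}. G3 t l * l)) \<and>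
         (\<forall>t>0. (\<forall>r\<ge>0. G1 t r \<ge> 0) \<and> antimono_on {0..} (G1 t))"
proof -
  have G1: "G1 t x = wave_function t x" if t: "0 < t" for t x
    using G1_fundamental[OF t] _ integrable_wave_function[OF t] isCont_wave_function[OF t] fourier_wave_function[OF t]
  proof (rule velocity_fundamental_function_unique)
    show "isCont (G1 t) x" using G1_continuous[OF t] by (simp add: continuous_on_eq_continuous_at)
  qed
  have G3: "G3 t l * l = (if l = 0 then 0 else exp (- t) / (4 * pi) * profile t l)" if t: "0 < t" and l: "0 \<le> l" for t l
  proof (cases "l = 0")
    case False
    then have lim: "Lim at_top (\<lambda>R. LBINT \<rho>:{0..R}. S1_hat t \<rho> * \<rho> * sin (l * \<rho>)) = exp (- t) * (pi / 2 * profile t l)"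
      using l by (intro tendsto_Lim sine_integral_S1_hat t) auto
    have "G3 t l = 1 / (2 * pi\<^sup>2 * l) * (exp (- t) * (pi / 2 * profile t l))"
      using False l G3_pointwise[OF t, of l] unfolding lim by simp
    then show ?thesis using False by (simp add: power2_eq_square)
  qed simp
  have part1: "set_integrable lborel {r..} (\<lambda>l. G3 t l * l)"
      "G1 t r = 2 * pi * (LBINT l:{r..}. G3 t l * l)" if t: "0 < t" and r: "0 \<le> r" for t r
  proof -
    let ?q = "\<lambda>l. exp (- t) / (4 * pi) * (indicator {r..} l * profile t l)"
    have q: "integrable lborel ?q" by (intro integrable_mult_right integrable_indicator_profile t) simp
    \<comment> \<open>At \<open>l = 0\<close> the left-hand side vanishes and the profile does not; one point does not matter.\<close>
    have eq: "indicator {r..} l *\<^sub>R (G3 t l * l) = ?q l" if "l \<noteq> 0" for l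
      using G3[OF t, of l] that r by (auto simp: indicator_def)
    show "set_integrable lborel {r..} (\<lambda>l. G3 t l * l)"
      unfolding set_integrable_def
      by (rule integrable_discrete_difference[where X = "{0}", THEN iffD1, OF _ _ _ _ q]) (use eq in auto)
    have "(LBINT l:{r..}. G3 t l * l) = integral\<^sup>L lborel ?q"
      unfolding set_lebesgue_integral_def
      by (rule integral_discrete_difference[where X = "{0}"]) (use eq in auto)
    then show "G1 t r = 2 * pi * (LBINT l:{r..}. G3 t l * l)"
      using r unfolding G1[OF t] wave_function_def integral_mult_right_zero by simp
  qed
  have "antimono_on {0..} (G1 t)" if t: "0 < t" for t
    by (rule monotone_onI) (auto simp: G1[OF t] intro!: wave_function_antimono t)
  moreover have "0 \<le> G1 t r" if "0 < t" for t r
    using that by (simp only: G1 wave_function_nonneg)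
  ultimately show ?thesis using part1 by blast
qed

end
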